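(* Let $\Lambda\subset\mathbb{R}^d$ be a bounded measurable set and let $\varphi$ be a zero mean complex Gaussian field on $\Lambda$ with $\mathbb{E}[\varphi(x)\varphi(y)]=0$ and $\mathbb{E}[\varphi(x)\varphi(y)^*]=C(x,y)$, admitting the Karhunen-Loève expansion $\varphi(x)=\sum_{n\ge 1}s_n\sqrt{\mu_n}\,\phi_n(x)$ described in the context. Let $T_C$ be the covariance operator on $L^2(\Lambda)$ with kernel $C$, and let $\kappa_1>0$ be its largest eigenvalue. Let $\hat\varphi=\varphi/\|\varphi\|_2$, and let $\hat\varphi_\bot$ be the component of $\hat\varphi$ orthogonal in $L^2(\Lambda)$ to the eigenspace of $T_C$ associated with $\kappa_1$. Assume that $\varphi$ is almost surely continuous on $\Lambda$ and that $$x\mapsto\langle x|T_C^{1/2}|x\rangle=\sum_{n\ge1}\sqrt{\mu_n}\,|\phi_n(x)|^2$$ is bounded in $\Lambda$. Then $$\lim_{r\to+\infty}\mathbb{E}\left(\|\hat\varphi_\bot\|_\infty\;\middle|\;\|\varphi\|_2^2>r\right)=0.$$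
   Context: $\|\cdot\|_2$ is the norm of $L^2(\Lambda)$ (complex-valued functions, Lebesgue measure) and $\|f\|_\infty=\sup_{x\in\Lambda}|f(x)|$ is the uniform norm on $\Lambda$. The covariance operator is $(T_Cf)(x)=\int_\Lambda C(x,y)f(y)\,d^dy$ for $f\in L^2(\Lambda)$; it is a nonnegative self-adjoint operator, assumed nonzero. Its eigenvalues, counted with multiplicity, are $\mu_1\ge\mu_2\ge\cdots\ge 0$ with $\mu_n\to0$, with corresponding orthonormal eigenfunctions $\phi_n$; for $\mu_n>0$ the function $\phi_n$ is defined at every point by $\phi_n(x)=\mu_n^{-1}\int_\Lambda C(x,y)\phi_n(y)\,d^dy$ (terms with $\mu_n=0$ contribute zero to all series). The distinct values taken by the $\mu_n$ are $\kappa_1>\kappa_2>\cdots$, so that $\kappa_1=\mu_1>0$. The variables $s_1,s_2,\dots$ are i.i.d. complex Gaussian (circularly symmetric) with $\mathbb{E}[s_n]=0$, $\mathbb{E}[s_ns_m]=0$, $\mathbb{E}[s_n^*s_m]=\delta_{nm}$. The field is given by its Karhunen-Loève expansion: for each $x\in\Lambda$, $\varphi(x)=\sum_{n\ge1}s_n\sqrt{\mu_n}\,\phi_n(x)$ almost surely. $\mathbb{P}$ is the law of the field and $\mathbb{E}$ the corresponding expectation. Letting $g_1$ be the (finite) multiplicity of $\kappa_1$, the projection onto the $\kappa_1$-eigenspace is $\varphi_\parallel=\sum_{n\le g_1}s_n\sqrt{\mu_n}\,\phi_n$, and $\varphi_\bot=\varphi-\varphi_\parallel$, $\hat\varphi_\bot=\varphi_\bot/\|\varphi\|_2$.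 *)

theory Defs
  imports "HOL-Probability.Probability"
begin

text \<open>Complex \<open>L\<^sup>2(\<Lambda>)\<close>: its elements are functions, to be compared up to null sets of \<open>\<Lambda>\<close>.\<close>

definition L2 :: "(real ^ 'd) set \<Rightarrow> ((real ^ 'd) \<Rightarrow> complex) set" where
  "L2 \<Lambda> = {f. f \<in> borel_measurable (lebesgue_on \<Lambda>) \<and>
               integrable (lebesgue_on \<Lambda>) (\<lambda>x. (cmod (f x))\<^sup>2)}"

definition L2_inner :: "(real ^ 'd) set \<Rightarrow> ((real ^ 'd) \<Rightarrow> complex) \<Rightarrow> ((real ^ 'd) \<Rightarrow> complex) \<Rightarrow> complex" where
  "L2_inner \<Lambda> f g = (\<integral>x. cnj (f x) * g x \<partial>lebesgue_on \<Lambda>)"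

definition L2_norm :: "(real ^ 'd) set \<Rightarrow> ((real ^ 'd) \<Rightarrow> complex) \<Rightarrow> real" where
  "L2_norm \<Lambda> f = sqrt (\<integral>x. (cmod (f x))\<^sup>2 \<partial>lebesgue_on \<Lambda>)"

text \<open>Extended-valued, since a function on \<open>\<Lambda>\<close> need not be bounded.\<close>

definition uniform_norm :: "(real ^ 'd) set \<Rightarrow> ((real ^ 'd) \<Rightarrow> complex) \<Rightarrow> ennreal" where
  "uniform_norm \<Lambda> f = (SUP x\<in>\<Lambda>. ennreal (cmod (f x)))"

definition cov_op :: "(real ^ 'd) set \<Rightarrow> ((real ^ 'd) \<Rightarrow> (real ^ 'd) \<Rightarrow> complex) \<Rightarrow>
    ((real ^ 'd) \<Rightarrow> complex) \<Rightarrow> (real ^ 'd) \<Rightarrow> complex" where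
  "cov_op \<Lambda> C f x = (\<integral>y. C x y * f y \<partial>lebesgue_on \<Lambda>)"

definition eigenspace :: "(real ^ 'd) set \<Rightarrow> ((real ^ 'd) \<Rightarrow> (real ^ 'd) \<Rightarrow> complex) \<Rightarrow>
    complex \<Rightarrow> ((real ^ 'd) \<Rightarrow> complex) set" where
  "eigenspace \<Lambda> C \<kappa> = {f \<in> L2 \<Lambda>. AE x in lebesgue_on \<Lambda>. cov_op \<Lambda> C f x = \<kappa> * f x}"

definition eigenvalue :: "(real ^ 'd) set \<Rightarrow> ((real ^ 'd) \<Rightarrow> (real ^ 'd) \<Rightarrow> complex) \<Rightarrow> complex \<Rightarrow> bool" where
  "eigenvalue \<Lambda> C \<kappa> \<longleftrightarrow> (\<exists>f \<in> eigenspace \<Lambda> C \<kappa>. \<not> (AE x in lebesgue_on \<Lambda>. f x = 0))"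

definition largest_eigenvalue :: "(real ^ 'd) set \<Rightarrow> ((real ^ 'd) \<Rightarrow> (real ^ 'd) \<Rightarrow> complex) \<Rightarrow> real \<Rightarrow> bool" where
  "largest_eigenvalue \<Lambda> C \<kappa> \<longleftrightarrow>
     eigenvalue \<Lambda> C (of_real \<kappa>) \<and> (\<forall>\<kappa>'. eigenvalue \<Lambda> C (of_real \<kappa>') \<longrightarrow> \<kappa>' \<le> \<kappa>)"

text \<open>
  The sequence \<open>\<mu>\<close> (indexed from 0) lists the eigenvalues of the covariance operator, counted with
  multiplicity, with orthonormal eigenfunctions \<open>e n\<close>. The clause on eigenspaces says that, for
  \<open>\<kappa> \<noteq> 0\<close>, the \<open>e n\<close> with \<open>\<mu> n = \<kappa>\<close> span the whole eigenspace, so that \<open>\<kappa>\<close> occurs in \<open>\<mu>\<close> exactly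
  as often as its multiplicity (a finite number, as \<open>\<mu>\<close> tends to 0). The eigenvalue 0 may be listed
  or not. The last clause fixes the pointwise version of \<open>e n\<close> when \<open>\<mu> n > 0\<close>.
\<close>

definition spectral_system :: "(real ^ 'd) set \<Rightarrow> ((real ^ 'd) \<Rightarrow> (real ^ 'd) \<Rightarrow> complex) \<Rightarrow>
    (nat \<Rightarrow> real) \<Rightarrow> (nat \<Rightarrow> (real ^ 'd) \<Rightarrow> complex) \<Rightarrow> bool" where
  "spectral_system \<Lambda> C \<mu> e \<longleftrightarrow>
     decseq \<mu> \<and> (\<forall>n. 0 \<le> \<mu> n) \<and> \<mu> \<longlonglongrightarrow> 0 \<and>
     (\<forall>n. e n \<in> eigenspace \<Lambda> C (of_real (\<mu> n))) \<and>
     (\<forall>m n. L2_inner \<Lambda> (e m) (e n) = (if m = n then 1 else 0)) \<and>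
     (\<forall>\<kappa> f. \<kappa> \<noteq> 0 \<and> f \<in> eigenspace \<Lambda> C \<kappa> \<longrightarrow>
        (\<exists>c. AE x in lebesgue_on \<Lambda>. f x = (\<Sum>n\<in>{n. of_real (\<mu> n) = \<kappa>}. c n * e n x))) \<and>
     (\<forall>n. 0 < \<mu> n \<longrightarrow> (\<forall>x\<in>\<Lambda>. e n x = inverse (of_real (\<mu> n)) * cov_op \<Lambda> C (e n) x))"

text \<open>Gaussian variables are allowed to be degenerate (almost surely constant).\<close>

definition gaussian_rv :: "'w measure \<Rightarrow> ('w \<Rightarrow> real) \<Rightarrow> bool" where
  "gaussian_rv M X \<longleftrightarrow> X \<in> borel_measurable M \<and>
     ((\<exists>m. AE \<omega> in M. X \<omega> = m) \<or>
      (\<exists>m \<sigma>. 0 < \<sigma> \<and> distributed M lborel X (\<lambda>x. ennreal (normal_density m \<sigma> x))))"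

text \<open>Every real-linear form on \<open>\<complex>\<close> is \<open>z \<mapsto> Re (c * z)\<close> for some \<open>c\<close>, so this is joint
  Gaussianity of the real and imaginary parts.\<close>

definition complex_gaussian_rv :: "'w measure \<Rightarrow> ('w \<Rightarrow> complex) \<Rightarrow> bool" where
  "complex_gaussian_rv M Z \<longleftrightarrow> (\<forall>c. gaussian_rv M (\<lambda>\<omega>. Re (c * Z \<omega>)))"

definition complex_gaussian_field :: "'w measure \<Rightarrow> 'i set \<Rightarrow> ('i \<Rightarrow> 'w \<Rightarrow> complex) \<Rightarrow> bool" where
  "complex_gaussian_field M I Z \<longleftrightarrow>
     (\<forall>J c. finite J \<and> J \<subseteq> I \<longrightarrow> complex_gaussian_rv M (\<lambda>\<omega>. \<Sum>i\<in>J. c i * Z i \<omega>))"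

definition iid_std_complex_gaussian :: "'w measure \<Rightarrow> (nat \<Rightarrow> 'w \<Rightarrow> complex) \<Rightarrow> bool" where
  "iid_std_complex_gaussian M s \<longleftrightarrow>
     prob_space.indep_vars M (\<lambda>_. borel) s UNIV \<and>
     (\<forall>m n. distr M borel (s m) = distr M borel (s n)) \<and>
     (\<forall>n. complex_gaussian_rv M (s n)) \<and>
     (\<forall>n \<theta>. distr M borel (\<lambda>\<omega>. cis \<theta> * s n \<omega>) = distr M borel (s n)) \<and>
     (\<forall>n. (\<integral>\<omega>. s n \<omega> \<partial>M) = 0) \<and>
     (\<forall>m n. (\<integral>\<omega>. s n \<omega> * s m \<omega> \<partial>M) = 0) \<and>
     (\<forall>m n. (\<integral>\<omega>. cnj (s n \<omega>) * s m \<omega> \<partial>M) = (if n = m then 1 else 0))"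

text \<open>
  Component of a sample path along the eigenspace of \<open>\<kappa>\<close>, where \<open>\<kappa>\<close> is the largest eigenvalue: as
  \<open>\<mu>\<close> is decreasing, the indices of the eigenfunctions for \<open>\<kappa>\<close> are those below its multiplicity.
\<close>

definition field_par :: "(nat \<Rightarrow> real) \<Rightarrow> (nat \<Rightarrow> (real ^ 'd) \<Rightarrow> complex) \<Rightarrow> (nat \<Rightarrow> 'w \<Rightarrow> complex) \<Rightarrow>
    real \<Rightarrow> 'w \<Rightarrow> (real ^ 'd) \<Rightarrow> complex" where
  "field_par \<mu> e s \<kappa> \<omega> x = (\<Sum>n<card {n. \<mu> n = \<kappa>}. s n \<omega> * of_real (sqrt (\<mu> n)) * e n x)"

definition field_perp_hat :: "(real ^ 'd) set \<Rightarrow> (nat \<Rightarrow> real) \<Rightarrow> (nat \<Rightarrow> (real ^ 'd) \<Rightarrow> complex) \<Rightarrow>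
    (nat \<Rightarrow> 'w \<Rightarrow> complex) \<Rightarrow> ((real ^ 'd) \<Rightarrow> 'w \<Rightarrow> complex) \<Rightarrow> real \<Rightarrow> 'w \<Rightarrow> (real ^ 'd) \<Rightarrow> complex" where
  "field_perp_hat \<Lambda> \<mu> e s \<phi> \<kappa> \<omega> x =
     (\<phi> x \<omega> - field_par \<mu> e s \<kappa> \<omega> x) / of_real (L2_norm \<Lambda> (\<lambda>y. \<phi> y \<omega>))"

end

theory Submission
  imports Defs
begin

text \<open>
  Write \<open>X = \<kappa>\<^sub>1 (\<bar>s\<^sub>1\<bar>\<^sup>2 + \<dots> + \<bar>s\<^sub>g\<bar>\<^sup>2)\<close> for the squared norm of the part of the field in the top
  eigenspace and \<open>W\<close> for that of the rest, so that the squared norm of the field is \<open>X + W\<close>. Integrating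
  the bound on the diagonal of the square root of the covariance shows that
  \<open>\<Sum>\<^sub>n sqrt \<mu>\<^sub>n\<close> converges, and the Cauchy--Schwarz inequality with weights \<open>sqrt \<mu>\<^sub>n\<close> bounds the
  orthogonal part uniformly by \<open>H = sqrt (B * (\<Sum>\<^sub>n\<^sub>>\<^sub>g sqrt \<mu>\<^sub>n * \<bar>s\<^sub>n\<bar>\<^sup>2))\<close>. As \<open>X\<close> is an Erlang
  variable independent of \<open>(H, W)\<close>, lowering the threshold \<open>r\<close> to \<open>r - W\<close> multiplies its tail by at most
  \<open>exp (W / \<kappa>\<^sub>1)\<close>. So the conditional expectation is at most \<open>E (H * exp (W / \<kappa>\<^sub>1)) / sqrt r\<close>, and
  this expectation is finite because \<open>\<mu>\<^sub>n < \<kappa>\<^sub>1\<close> for \<open>n > g\<close>.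
\<close>

subsection \<open>The squared modulus of a complex Gaussian variable\<close>

text \<open>Two inputs have to be produced before that estimate can start. The Gaussian hypotheses
  speak only of real-linear forms, so the exponential law of each squared modulus comes from normal
  projections, whose characteristic functions make the real and imaginary parts independent.
  Moreover the expansion holds at each point off a null set depending on that point, and the
  \<open>e n\<close> are not assumed continuous, whereas the uniform bound and the formula for the
  squared norm need one null set for all of \<Lambda>. Continuity of
  \<open>sqrt (\<mu> n) * e n\<close> is obtained by writing it as the expectation of
  \<open>cnj (s n) * \<phi> x\<close>, through which continuity of the paths passes. The final ratio
  needs no asymptotics of the tail: as \<open>W\<close> is nonnegative, the conditioning event has
  at least the probability of \<open>X > r\<close>, and exactly this probability appears as a factor
  in the bound of the numerator, so it cancels. The power of \<open>r\<close> that remains comes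
  from the normalisation by the norm alone.\<close>

context prob_space begin

text \<open>Normalising \<open>h\<close> to a probability density gives a measure \<open>N\<close>
  under which \<open>X\<close> has the same characteristic function as under \<open>M\<close>, hence
  the same law by Levy uniqueness. A weight of mean zero cannot be normalised, but it vanishes
  almost everywhere.\<close>

lemma weighted_law_of_char:
  fixes X h :: "'a \<Rightarrow> real"
  assumes [measurable]: "X \<in> borel_measurable M" "h \<in> borel_measurable M" "A \<in> sets borel"
    and h: "\<And>\<omega>. \<omega> \<in> space M \<Longrightarrow> 0 \<le> h \<omega>" "\<And>\<omega>. \<omega> \<in> space M \<Longrightarrow> h \<omega> \<le> c"
    and char: "\<And>t. (\<integral>\<omega>. h \<omega> * iexp (t * X \<omega>) \<partial>M) = of_real (\<integral>\<omega>. h \<omega> \<partial>M) * (\<integral>\<omega>. iexp (t * X \<omega>) \<partial>M)"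
  shows "(\<integral>\<omega>. h \<omega> * indicator A (X \<omega>) \<partial>M) = (\<integral>\<omega>. h \<omega> \<partial>M) * measure (distr M borel X) A"
proof -
  have int: "integrable M h"
    by (rule integrable_const_bound[of _ c]) (use h in auto)
  define k where "k = (\<integral>\<omega>. h \<omega> \<partial>M)"
  have "0 \<le> k" unfolding k_def by (rule integral_nonneg_AE) (use h in auto)
  show ?thesis
  proof (cases "k = 0")
    case True
    then have "AE \<omega> in M. h \<omega> = 0"
      unfolding k_def by (subst (asm) integral_nonneg_eq_0_iff_AE) (use h int in auto)
    then have "(\<integral>\<omega>. h \<omega> * indicator A (X \<omega>) \<partial>M) = (\<integral>\<omega>. 0 \<partial>M)"
      by (intro integral_cong_AE) auto
    with True show ?thesis by (simp add: k_def)
  next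
    case False
    with \<open>0 \<le> k\<close> have k: "0 < k" by simp
    define N where "N = density M (\<lambda>\<omega>. ennreal (h \<omega> / k))"
    have [measurable_cong]: "sets N = sets M" by (simp add: N_def)
    interpret N: prob_space N
    proof
      have "emeasure N (space N) = (\<integral>\<^sup>+\<omega>. ennreal (h \<omega> / k) \<partial>M)"
        by (simp add: N_def emeasure_density cong: nn_integral_cong)
      also have "\<dots> = ennreal (\<integral>\<omega>. h \<omega> / k \<partial>M)"
        by (rule nn_integral_eq_integral) (use int h k in auto)
      also have "\<dots> = 1" using k by (simp add: k_def)
      finally show "emeasure N (space N) = 1" .
    qed
    have eq: "distr N borel X = distr M borel X"
    proof (rule Levy_uniqueness)
      show "real_distribution (distr N borel X)"
        by (simp add: real_distribution_def real_distribution_axioms_def N.prob_space_distr)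
      show "real_distribution (distr M borel X)"
        by (simp add: real_distribution_def real_distribution_axioms_def prob_space_distr)
      show "char (distr N borel X) = char (distr M borel X)"
      proof
        fix t
        have "char (distr N borel X) t = (\<integral>\<omega>. iexp (t * X \<omega>) \<partial>N)"
          unfolding char_def by (subst integral_distr) auto
        also have "\<dots> = (\<integral>\<omega>. (h \<omega> / k) *\<^sub>R iexp (t * X \<omega>) \<partial>M)"
          unfolding N_def by (subst integral_density) (use h k in auto)
        also have "\<dots> = (\<integral>\<omega>. (h \<omega> * iexp (t * X \<omega>)) / k \<partial>M)"
          by (intro Bochner_Integration.integral_cong) (auto simp: scaleR_conv_of_real)
        also have "\<dots> = (\<integral>\<omega>. h \<omega> * iexp (t * X \<omega>) \<partial>M) / k" by simp
        also have "\<dots> = (\<integral>\<omega>. iexp (t * X \<omega>) \<partial>M)"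
          unfolding char k_def[symmetric] using k by simp
        also have "\<dots> = char (distr M borel X) t"
          unfolding char_def by (subst integral_distr) auto
        finally show "char (distr N borel X) t = char (distr M borel X) t" .
      qed
    qed
    have "measure (distr N borel X) A = (\<integral>\<omega>. indicator A (X \<omega>) \<partial>N)"
    proof -
      have "measure (distr N borel X) A = (\<integral>x. indicator A x \<partial>distr N borel X)"
        by simp
      also have "\<dots> = (\<integral>\<omega>. indicator A (X \<omega>) \<partial>N)" by (subst integral_distr) auto
      finally show ?thesis .
    qed
    also have "\<dots> = (\<integral>\<omega>. (h \<omega> / k) *\<^sub>R indicator A (X \<omega>) \<partial>M)"
      unfolding N_def by (subst integral_density) (use h k in auto)
    also have "\<dots> = (\<integral>\<omega>. h \<omega> * indicator A (X \<omega>) \<partial>M) / k" by simp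
    finally show ?thesis using k by (simp add: eq k_def field_simps)
  qed
qed

text \<open>
  Weighting by \<open>2 + cos (b Y)\<close> and \<open>2 + sin (b Y)\<close> leaves the characteristic function of \<open>X\<close>
  unchanged up to a factor, which reduces Kac's theorem to Levy's uniqueness theorem on the line.
\<close>

lemma indep_var_of_char:
  fixes X Y :: "'a \<Rightarrow> real"
  assumes [measurable]: "X \<in> borel_measurable M" "Y \<in> borel_measurable M"
    and char: "\<And>a b. (\<integral>\<omega>. iexp (a * X \<omega> + b * Y \<omega>) \<partial>M) =
      (\<integral>\<omega>. iexp (a * X \<omega>) \<partial>M) * (\<integral>\<omega>. iexp (b * Y \<omega>) \<partial>M)"
  shows "indep_var borel X borel Y"
proof -
  have iX[simp]: "integrable M (\<lambda>\<omega>. iexp (f \<omega>))" if [measurable]: "f \<in> borel_measurable M" for f :: "'a \<Rightarrow> real"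
    by (rule integrable_const_bound[of _ 1]) auto
  have lin: "(\<integral>\<omega>. F \<omega> + (G \<omega> + H \<omega>) / 2 \<partial>M) = (\<integral>\<omega>. F \<omega> \<partial>M) + ((\<integral>\<omega>. G \<omega> \<partial>M) + (\<integral>\<omega>. H \<omega> \<partial>M)) / 2"
      "(\<integral>\<omega>. F \<omega> + (G \<omega> - H \<omega>) / (2 * \<i>) \<partial>M) =
        (\<integral>\<omega>. F \<omega> \<partial>M) + ((\<integral>\<omega>. G \<omega> \<partial>M) - (\<integral>\<omega>. H \<omega> \<partial>M)) / (2 * \<i>)"
    if "integrable M F" "integrable M G" "integrable M H" for F G H :: "'a \<Rightarrow> complex"
    using that by simp_all
  \<comment> \<open>Halfway to independence: an indicator in \<open>X\<close> against a character in
    \<open>Y\<close>. The constant 2 keeps the two trigonometric weights between 0 and 3, as a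
    density requires.\<close>
  have exp_b: "(\<integral>\<omega>. indicator A (X \<omega>) * iexp (b * Y \<omega>) \<partial>M) =
      of_real (measure (distr M borel X) A) * (\<integral>\<omega>. iexp (b * Y \<omega>) \<partial>M)"
    if [measurable]: "A \<in> sets borel" for A b
  proof -
    have intc: "integrable M (\<lambda>\<omega>. cos (b * Y \<omega>))" "integrable M (\<lambda>\<omega>. sin (b * Y \<omega>))"
      by (rule integrable_const_bound[of _ 1]; auto)+
    have intA: "integrable M (\<lambda>\<omega>. indicator A (X \<omega>) :: real)"
      by (rule integrable_const_bound[of _ 1]) (auto simp: indicator_def)
    have intcA: "integrable M (\<lambda>\<omega>. cos (b * Y \<omega>) * indicator A (X \<omega>))"
      "integrable M (\<lambda>\<omega>. sin (b * Y \<omega>) * indicator A (X \<omega>))"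
      by (rule integrable_const_bound[of _ 1]; auto simp: indicator_def)+
    have A: "(\<integral>\<omega>. indicator A (X \<omega>) \<partial>M) = measure (distr M borel X) A"
      by (simp add: integral_distr[symmetric, of X M borel "indicator A :: real \<Rightarrow> real"])
    \<comment> \<open>Written with exponentials, the weights become combinations of characters at
      \<open>b\<close> and \<open>-b\<close>, to which the factorisation hypothesis applies.\<close>
    have decomp: "(2 + cos y) = 2 + (iexp y + iexp (- y)) / 2"
       "complex_of_real (2 + sin y) = 2 + (iexp y - iexp (- y)) / (2 * \<i>)" for y :: real
      by (auto simp: complex_eq_iff exp_minus Re_exp Im_exp cis_conv_exp[symmetric])
    have c: "(\<integral>\<omega>. (2 + cos (b * Y \<omega>)) * indicator A (X \<omega>) \<partial>M) =
        (\<integral>\<omega>. 2 + cos (b * Y \<omega>) \<partial>M) * measure (distr M borel X) A"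
    proof (rule weighted_law_of_char[where c = 3])
      fix t
      have "(\<integral>\<omega>. complex_of_real (2 + cos (b * Y \<omega>)) * iexp (t * X \<omega>) \<partial>M) =
        (\<integral>\<omega>. 2 * iexp (t * X \<omega>) + (iexp (t * X \<omega> + b * Y \<omega>) + iexp (t * X \<omega> + (- b) * Y \<omega>)) / 2 \<partial>M)"
        unfolding decomp by (intro Bochner_Integration.integral_cong) (auto simp: field_simps simp flip: exp_add)
      also have "\<dots> = 2 * (\<integral>\<omega>. iexp (t * X \<omega>) \<partial>M) + ((\<integral>\<omega>. iexp (t * X \<omega> + b * Y \<omega>) \<partial>M) +
        (\<integral>\<omega>. iexp (t * X \<omega> + (- b) * Y \<omega>) \<partial>M)) / 2"
        by (subst lin(1)[OF integrable_mult_right[OF iX] iX iX]) auto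
      also have "\<dots> = (\<integral>\<omega>. iexp (t * X \<omega>) \<partial>M) *
         (2 + ((\<integral>\<omega>. iexp (b * Y \<omega>) \<partial>M) + (\<integral>\<omega>. iexp ((- b) * Y \<omega>) \<partial>M)) / 2)"
        unfolding char by (simp add: field_simps)
      also have "(2 + ((\<integral>\<omega>. iexp (b * Y \<omega>) \<partial>M) + (\<integral>\<omega>. iexp ((- b) * Y \<omega>) \<partial>M)) / 2) =
        (\<integral>\<omega>. 2 + (iexp (b * Y \<omega>) + iexp ((- b) * Y \<omega>)) / 2 \<partial>M)"
        by (subst lin(1)[OF integrable_const iX iX]) (auto simp: prob_space)
      also have "\<dots> = of_real (\<integral>\<omega>. 2 + cos (b * Y \<omega>) \<partial>M)"
        unfolding integral_complex_of_real[symmetric] decomp by simp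
      finally show "(\<integral>\<omega>. complex_of_real (2 + cos (b * Y \<omega>)) * iexp (t * X \<omega>) \<partial>M) =
         of_real (\<integral>\<omega>. 2 + cos (b * Y \<omega>) \<partial>M) * (\<integral>\<omega>. iexp (t * X \<omega>) \<partial>M)" by simp
    next
      fix \<omega> show "0 \<le> 2 + cos (b * Y \<omega>)" "2 + cos (b * Y \<omega>) \<le> 3"
        using cos_ge_minus_one[of "b * Y \<omega>"] cos_le_one[of "b * Y \<omega>"] by linarith+
    qed auto
    have s: "(\<integral>\<omega>. (2 + sin (b * Y \<omega>)) * indicator A (X \<omega>) \<partial>M) =
        (\<integral>\<omega>. 2 + sin (b * Y \<omega>) \<partial>M) * measure (distr M borel X) A"
    proof (rule weighted_law_of_char[where c = 3])
      fix t
      have "(\<integral>\<omega>. complex_of_real (2 + sin (b * Y \<omega>)) * iexp (t * X \<omega>) \<partial>M) =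
        (\<integral>\<omega>. 2 * iexp (t * X \<omega>) + (iexp (t * X \<omega> + b * Y \<omega>) - iexp (t * X \<omega> + (- b) * Y \<omega>)) / (2 * \<i>) \<partial>M)"
        unfolding decomp by (intro Bochner_Integration.integral_cong) (auto simp: field_simps simp flip: exp_add)
      also have "\<dots> = 2 * (\<integral>\<omega>. iexp (t * X \<omega>) \<partial>M) + ((\<integral>\<omega>. iexp (t * X \<omega> + b * Y \<omega>) \<partial>M) -
        (\<integral>\<omega>. iexp (t * X \<omega> + (- b) * Y \<omega>) \<partial>M)) / (2 * \<i>)"
        by (subst lin(2)[OF integrable_mult_right[OF iX] iX iX]) auto
      also have "\<dots> = (\<integral>\<omega>. iexp (t * X \<omega>) \<partial>M) *
         (2 + ((\<integral>\<omega>. iexp (b * Y \<omega>) \<partial>M) - (\<integral>\<omega>. iexp ((- b) * Y \<omega>) \<partial>M)) / (2 * \<i>))"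
        unfolding char by (simp add: field_simps)
      also have "(2 + ((\<integral>\<omega>. iexp (b * Y \<omega>) \<partial>M) - (\<integral>\<omega>. iexp ((- b) * Y \<omega>) \<partial>M)) / (2 * \<i>)) =
        (\<integral>\<omega>. 2 + (iexp (b * Y \<omega>) - iexp ((- b) * Y \<omega>)) / (2 * \<i>) \<partial>M)"
        by (subst lin(2)[OF integrable_const iX iX]) (auto simp: prob_space)
      also have "\<dots> = of_real (\<integral>\<omega>. 2 + sin (b * Y \<omega>) \<partial>M)"
        unfolding integral_complex_of_real[symmetric] decomp by simp
      finally show "(\<integral>\<omega>. complex_of_real (2 + sin (b * Y \<omega>)) * iexp (t * X \<omega>) \<partial>M) =
         of_real (\<integral>\<omega>. 2 + sin (b * Y \<omega>) \<partial>M) * (\<integral>\<omega>. iexp (t * X \<omega>) \<partial>M)" by simp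
    next
      fix \<omega> show "0 \<le> 2 + sin (b * Y \<omega>)" "2 + sin (b * Y \<omega>) \<le> 3"
        using sin_ge_minus_one[of "b * Y \<omega>"] sin_le_one[of "b * Y \<omega>"] by linarith+
    qed auto
    \<comment> \<open>The constant part of the weight contributes twice the law of \<open>X\<close>
      on both sides and cancels.\<close>
    have c': "(\<integral>\<omega>. cos (b * Y \<omega>) * indicator A (X \<omega>) \<partial>M) = (\<integral>\<omega>. cos (b * Y \<omega>) \<partial>M) * measure (distr M borel X) A"
      using c intc intA intcA A by (simp add: distrib_right prob_space)
    have s': "(\<integral>\<omega>. sin (b * Y \<omega>) * indicator A (X \<omega>) \<partial>M) = (\<integral>\<omega>. sin (b * Y \<omega>) \<partial>M) * measure (distr M borel X) A"
      using s intc intA intcA A by (simp add: distrib_right prob_space)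
    have iA: "integrable M (\<lambda>\<omega>. indicator A (X \<omega>) * iexp (b * Y \<omega>))"
      by (rule integrable_const_bound[of _ 1]) (auto simp: indicator_def)
    have "Re (\<integral>\<omega>. indicator A (X \<omega>) * iexp (b * Y \<omega>) \<partial>M) = (\<integral>\<omega>. cos (b * Y \<omega>) * indicator A (X \<omega>) \<partial>M)"
      unfolding integral_Re[OF iA, symmetric]
      by (intro Bochner_Integration.integral_cong) (auto simp: indicator_def Re_exp)
    moreover have "Im (\<integral>\<omega>. indicator A (X \<omega>) * iexp (b * Y \<omega>) \<partial>M) = (\<integral>\<omega>. sin (b * Y \<omega>) * indicator A (X \<omega>) \<partial>M)"
      unfolding integral_Im[OF iA, symmetric]
      by (intro Bochner_Integration.integral_cong) (auto simp: indicator_def Im_exp)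
    moreover have "Re (\<integral>\<omega>. iexp (b * Y \<omega>) \<partial>M) = (\<integral>\<omega>. cos (b * Y \<omega>) \<partial>M)"
      by (subst integral_Re[OF iX, symmetric]) (auto simp: Re_exp)
    moreover have "Im (\<integral>\<omega>. iexp (b * Y \<omega>) \<partial>M) = (\<integral>\<omega>. sin (b * Y \<omega>) \<partial>M)"
      by (subst integral_Im[OF iX, symmetric]) (auto simp: Im_exp)
    ultimately show ?thesis by (simp add: complex_eq_iff c' s')
  qed
  have prod: "measure M (X -` A \<inter> Y -` B \<inter> space M) = measure (distr M borel X) A * measure (distr M borel Y) B"
    if [measurable]: "A \<in> sets borel" "B \<in> sets borel" for A B
  proof -
    have A: "(\<integral>\<omega>. indicator A (X \<omega>) \<partial>M) = measure (distr M borel X) A"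
      by (simp add: integral_distr[symmetric, of X M borel "indicator A :: real \<Rightarrow> real"])
    \<comment> \<open>The same principle with the roles exchanged: the weight is now the indicator
      in \<open>X\<close>, and \<open>exp_b\<close> is the required factorisation of characters of
      \<open>Y\<close>.\<close>
    have "(\<integral>\<omega>. indicator A (X \<omega>) * indicator B (Y \<omega>) \<partial>M) = (\<integral>\<omega>. indicator A (X \<omega>) \<partial>M) * measure (distr M borel Y) B"
    proof (rule weighted_law_of_char[where c = 1])
      fix t
      have "(\<integral>\<omega>. complex_of_real (indicator A (X \<omega>)) * iexp (t * Y \<omega>) \<partial>M) = (\<integral>\<omega>. indicator A (X \<omega>) * iexp (t * Y \<omega>) \<partial>M)"
        by (intro Bochner_Integration.integral_cong) (auto simp: indicator_def)
      then show "(\<integral>\<omega>. complex_of_real (indicator A (X \<omega>)) * iexp (t * Y \<omega>) \<partial>M) =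
        of_real (\<integral>\<omega>. indicator A (X \<omega>) \<partial>M) * (\<integral>\<omega>. iexp (t * Y \<omega>) \<partial>M)"
        by (simp only: exp_b[OF that(1)] A)
    qed (auto simp: indicator_def)
    moreover have "(\<integral>\<omega>. indicator A (X \<omega>) * indicator B (Y \<omega>) \<partial>M) = (\<integral>\<omega>. (indicator (X -` A \<inter> Y -` B \<inter> space M) \<omega> :: real) \<partial>M)"
      by (intro Bochner_Integration.integral_cong) (auto simp: indicator_def)
    moreover have "X -` A \<inter> Y -` B \<inter> space M \<inter> space M = X -` A \<inter> Y -` B \<inter> space M" by auto
    ultimately show ?thesis by (simp add: A)
  qed
  interpret X: prob_space "distr M borel X" by (rule prob_space_distr) simp
  interpret Y: prob_space "distr M borel Y" by (rule prob_space_distr) simp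
  show ?thesis
    unfolding indep_var_distribution_eq
  proof (intro conjI pair_measure_eqI)
    fix A B assume "A \<in> sets (distr M borel X)" "B \<in> sets (distr M borel Y)"
    then have [measurable]: "A \<in> sets borel" "B \<in> sets borel" by auto
    have "emeasure (distr M (borel \<Otimes>\<^sub>M borel) (\<lambda>x. (X x, Y x))) (A \<times> B) = emeasure M (X -` A \<inter> Y -` B \<inter> space M)"
      by (subst emeasure_distr) (auto intro!: arg_cong[where f="emeasure M"])
    then show "emeasure (distr M borel X) A * emeasure (distr M borel Y) B =
       emeasure (distr M (borel \<Otimes>\<^sub>M borel) (\<lambda>x. (X x, Y x))) (A \<times> B)"
      by (simp add: X.emeasure_eq_measure Y.emeasure_eq_measure emeasure_eq_measure prod ennreal_mult)
  qed (auto intro: X.sigma_finite_measure_axioms Y.sigma_finite_measure_axioms)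
qed

end

section \<open>From a planar Gaussian pair to the exponential law\<close>

lemma emeasure_exponential_greaterThan:
  assumes "0 \<le> q"
  shows "emeasure (density lborel (exponential_density 1)) {q<..} = ennreal (exp (- q))"
proof -
  interpret E: prob_space "density lborel (exponential_density 1)"
    by (rule prob_space_exponential_density) simp
  have 1: "measure (density lborel (exponential_density 1)) {..q} = 1 - exp (- q)"
    unfolding measure_def using assms by (subst emeasure_erlang_density) (auto simp: erlang_CDF_def)
  have "{q<..} = UNIV - {..q}" by auto
  then show ?thesis
    using E.prob_compl[of "{..q}"] by (simp add: E.emeasure_eq_measure 1)
qed

text \<open>The parameter is half the squared radius, as in the Gaussian exponent, so the area is
  linear in it. Both versions occur below: a point lies under a strict level from the layer cake and
  under the weak bound of a distribution function, and either may be the smaller.\<close>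

lemma emeasure_disc:
  assumes "0 \<le> r"
  shows "emeasure (lborel \<Otimes>\<^sub>M lborel) {(x, y). (x\<^sup>2 + y\<^sup>2) / 2 \<le> (r::real)} = ennreal (2 * pi * r)"
    and "emeasure (lborel \<Otimes>\<^sub>M lborel) {(x, y). (x\<^sup>2 + y\<^sup>2) / 2 < (r::real)} = ennreal (2 * pi * r)"
proof -
  have "{(x, y). (x\<^sup>2 + y\<^sup>2) / 2 \<le> r} = cball (0 :: real \<times> real) (sqrt (2 * r))"
    by (auto simp: dist_norm norm_Pair)
  then show "emeasure (lborel \<Otimes>\<^sub>M lborel) {(x, y). (x\<^sup>2 + y\<^sup>2) / 2 \<le> (r::real)} = ennreal (2 * pi * r)"
    using assms by (simp add: lborel_prod emeasure_cball unit_ball_vol_2)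
  have "{(x, y). (x\<^sup>2 + y\<^sup>2) / 2 < r} = ball (0 :: real \<times> real) (sqrt (2 * r))"
    by (auto simp: dist_norm norm_Pair)
  then show "emeasure (lborel \<Otimes>\<^sub>M lborel) {(x, y). (x\<^sup>2 + y\<^sup>2) / 2 < (r::real)} = ennreal (2 * pi * r)"
    using assms by (simp add: lborel_prod emeasure_ball unit_ball_vol_2)
qed

text \<open>
  Layer-cake computation: the joint density at \<open>(x, y)\<close> is \<open>1 / (2 * pi)\<close> times the exponential
  measure of the half-line above \<open>(x\<^sup>2 + y\<^sup>2) / 2\<close>, so only areas of discs are needed.
\<close>

lemma (in prob_space) exponential_half_sum_squares:
  fixes X Y :: "'a \<Rightarrow> real"
  assumes X: "distributed M lborel X std_normal_density"
    and Y: "distributed M lborel Y std_normal_density"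
    and ind: "indep_var borel X borel Y"
  shows "distributed M lborel (\<lambda>\<omega>. ((X \<omega>)\<^sup>2 + (Y \<omega>)\<^sup>2) / 2) (exponential_density 1)"
proof (rule exponential_distributedI)
  have [measurable]: "X \<in> borel_measurable M" "Y \<in> borel_measurable M"
    using X Y by (auto dest: distributed_measurable)
  show "(\<lambda>\<omega>. ((X \<omega>)\<^sup>2 + (Y \<omega>)\<^sup>2) / 2) \<in> borel_measurable M" by simp
  fix a :: real assume a: "0 \<le> a"
  interpret E: prob_space "density lborel (exponential_density 1)"
    by (rule prob_space_exponential_density) simp
  define E where "E = density lborel (exponential_density 1)"
  interpret P: pair_sigma_finite "lborel \<Otimes>\<^sub>M lborel :: (real \<times> real) measure" E
    unfolding E_def pair_sigma_finite_def using E.sigma_finite_measure_axioms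
    by (simp add: lborel_prod lborel.sigma_finite_measure_axioms)
  let ?q = "\<lambda>z. ((fst z)\<^sup>2 + (snd z)\<^sup>2) / 2 :: real"
  have [measurable_cong]: "sets E = sets borel" by (simp add: E_def)
  have D: "distributed M (lborel \<Otimes>\<^sub>M lborel) (\<lambda>\<omega>. (X \<omega>, Y \<omega>))
      (\<lambda>(x, y). ennreal (std_normal_density x) * ennreal (std_normal_density y))"
  proof (rule distributed_joint_indep[OF _ _ X Y])
    show "indep_var lborel X lborel Y" using ind unfolding indep_var_eq by simp
  qed (rule lborel.sigma_finite_measure_axioms)+
  have dens: "ennreal (std_normal_density x) * ennreal (std_normal_density y) =
      ennreal (1 / (2 * pi)) * (\<integral>\<^sup>+u. indicator {?q (x, y)<..} u \<partial>E)" for x y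
  proof -
    have "(\<integral>\<^sup>+u. indicator {?q (x, y)<..} u \<partial>E) = ennreal (exp (- ?q (x, y)))"
      by (simp add: E_def emeasure_exponential_greaterThan)
    moreover have "std_normal_density x * std_normal_density y = 1 / (2 * pi) * exp (- ?q (x, y))"
    proof -
      have "exp (- x\<^sup>2 / 2) * exp (- y\<^sup>2 / 2) = exp (- ?q (x, y))"
        unfolding exp_add[symmetric] by (simp add: add_divide_distrib)
      then show ?thesis by (simp add: std_normal_density_def)
    qed
    then have "ennreal (std_normal_density x) * ennreal (std_normal_density y) =
        ennreal (1 / (2 * pi)) * ennreal (exp (- ?q (x, y)))"
      by (subst (1 2) ennreal_mult[symmetric]) auto
    ultimately show ?thesis by simp
  qed
  have "emeasure M {\<omega> \<in> space M. ?q (X \<omega>, Y \<omega>) \<le> a} =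
      (\<integral>\<^sup>+\<omega>. indicator {\<omega> \<in> space M. ?q (X \<omega>, Y \<omega>) \<le> a} \<omega> \<partial>M)"
    by (rule nn_integral_indicator[symmetric]) simp
  also have "\<dots> = (\<integral>\<^sup>+\<omega>. indicator {z. ?q z \<le> a} (X \<omega>, Y \<omega>) \<partial>M)"
    by (intro nn_integral_cong) (simp add: indicator_def)
  also have "\<dots> = (\<integral>\<^sup>+z. (case z of (x, y) \<Rightarrow> ennreal (std_normal_density x) * ennreal (std_normal_density y))
      * indicator {z. ?q z \<le> a} z \<partial>(lborel \<Otimes>\<^sub>M lborel))"
    by (rule distributed_nn_integral[OF D, symmetric]) simp
  also have "\<dots> = (\<integral>\<^sup>+z. ennreal (1 / (2 * pi)) *
      (\<integral>\<^sup>+u. (if ?q z < u \<and> ?q z \<le> a then 1 else 0) \<partial>E) \<partial>(lborel \<Otimes>\<^sub>M lborel))"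
  proof (rule nn_integral_cong)
    fix z :: "real \<times> real"
    have "(\<integral>\<^sup>+u. (if ?q z < u \<and> ?q z \<le> a then 1 else 0) \<partial>E) =
      (\<integral>\<^sup>+u. indicator {?q z<..} u * indicator {z. ?q z \<le> a} z \<partial>E)"
      by (intro nn_integral_cong) (auto simp: indicator_def)
    also have "\<dots> = (\<integral>\<^sup>+u. indicator {?q z<..} u \<partial>E) * indicator {z. ?q z \<le> a} z"
      by (rule nn_integral_multc) simp
    finally have *: "(\<integral>\<^sup>+u. (if ?q z < u \<and> ?q z \<le> a then 1 else 0) \<partial>E) =
      (\<integral>\<^sup>+u. indicator {?q z<..} u \<partial>E) * indicator {z. ?q z \<le> a} z" .
    show "(case z of (x, y) \<Rightarrow> ennreal (std_normal_density x) * ennreal (std_normal_density y)) *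
        indicator {z. ?q z \<le> a} z =
      ennreal (1 / (2 * pi)) * (\<integral>\<^sup>+u. (if ?q z < u \<and> ?q z \<le> a then 1 else 0) \<partial>E)"
      unfolding * using dens[of "fst z" "snd z"] by (simp only: split_beta prod.collapse mult.assoc)
  qed
  also have "\<dots> = ennreal (1 / (2 * pi)) *
      (\<integral>\<^sup>+z. (\<integral>\<^sup>+u. (if ?q z < u \<and> ?q z \<le> a then 1 else 0) \<partial>E) \<partial>(lborel \<Otimes>\<^sub>M lborel))"
    by (rule nn_integral_cmult) measurable
  also have "(\<integral>\<^sup>+z. (\<integral>\<^sup>+u. (if ?q z < u \<and> ?q z \<le> a then 1 else 0) \<partial>E) \<partial>(lborel \<Otimes>\<^sub>M lborel)) =
      (\<integral>\<^sup>+u. (\<integral>\<^sup>+z. (if ?q z < u \<and> ?q z \<le> a then 1 else 0) \<partial>(lborel \<Otimes>\<^sub>M lborel)) \<partial>E)"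
    by (rule P.Fubini'[symmetric]) measurable
  \<comment> \<open>The area \<open>2 * pi * min u a\<close> is written as \<open>2 * pi\<close>
    times the length of an interval of levels \<open>v\<close>, in order to apply Fubini a second
    time, now to \<open>u\<close> and \<open>v\<close>.\<close>
  also have "\<dots> = (\<integral>\<^sup>+u. ennreal (2 * pi) * (\<integral>\<^sup>+v. (if 0 \<le> v \<and> v \<le> a \<and> v < u then 1 else 0) \<partial>lborel) \<partial>E)"
  proof (rule nn_integral_cong)
    fix u
    have "(\<integral>\<^sup>+z. (if ?q z < u \<and> ?q z \<le> a then 1 else 0) \<partial>(lborel \<Otimes>\<^sub>M lborel)) =
      (\<integral>\<^sup>+z. indicator {z. ?q z < u \<and> ?q z \<le> a} z \<partial>(lborel \<Otimes>\<^sub>M lborel))"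
      by (intro nn_integral_cong) (auto simp: indicator_def)
    also have "\<dots> = emeasure (lborel \<Otimes>\<^sub>M lborel) {z. ?q z < u \<and> ?q z \<le> a}"
    proof (rule nn_integral_indicator)
      have "Measurable.pred (lborel \<Otimes>\<^sub>M lborel) (\<lambda>z. ?q z < u \<and> ?q z \<le> a)"
        by measurable
      then show "{z. ?q z < u \<and> ?q z \<le> a} \<in> sets (lborel \<Otimes>\<^sub>M lborel)"
        by (simp add: pred_def space_pair_measure)
    qed
    also have "\<dots> = ennreal (2 * pi * max 0 (min u a))"
    proof (cases "u \<le> a")
      case True
      show ?thesis
      proof (cases "0 \<le> u")
        case nn: True
        have "{z. ?q z < u \<and> ?q z \<le> a} = {(x, y). (x\<^sup>2 + y\<^sup>2) / 2 < u}"
          using True by auto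
        then show ?thesis using True nn emeasure_disc(2)[OF nn] by simp
      next
        case False
        have "0 \<le> ?q z" for z by simp
        then have "{z. ?q z < u \<and> ?q z \<le> a} = {}" using False by (smt (verit) Collect_empty_eq)
        then show ?thesis using False True by (simp only:) (simp add: max_def min_def)
      qed
    next
      case False
      then have "{z. ?q z < u \<and> ?q z \<le> a} = {(x, y). (x\<^sup>2 + y\<^sup>2) / 2 \<le> a}" by auto
      then show ?thesis using False a emeasure_disc(1)[OF a] by simp
    qed
    also have "\<dots> = ennreal (2 * pi) * ennreal (max 0 (min u a))"
      by (simp add: ennreal_mult')
    also have "ennreal (max 0 (min u a)) = (\<integral>\<^sup>+v. (if 0 \<le> v \<and> v \<le> a \<and> v < u then 1 else 0) \<partial>lborel)"
    proof -
      have "(\<integral>\<^sup>+v. (if 0 \<le> v \<and> v \<le> a \<and> v < u then 1 else 0) \<partial>lborel) =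
          (\<integral>\<^sup>+v. indicator ({0..a} \<inter> {..<u}) v \<partial>lborel)"
        by (intro nn_integral_cong) (auto simp: indicator_def)
      also have "\<dots> = emeasure lborel ({0..a} \<inter> {..<u})" by simp
      also have "{0..a} \<inter> {..<u} = (if u \<le> a then {0..<u} else {0..a})" by auto
      also have "emeasure lborel (if u \<le> a then {0..<u} else {0..a}) = ennreal (max 0 (min u a))"
        using a by (cases "0 \<le> u") (auto simp: max_def min_def)
      finally show ?thesis ..
    qed
    finally show "(\<integral>\<^sup>+z. (if ?q z < u \<and> ?q z \<le> a then 1 else 0) \<partial>(lborel \<Otimes>\<^sub>M lborel)) =
      ennreal (2 * pi) * (\<integral>\<^sup>+v. (if 0 \<le> v \<and> v \<le> a \<and> v < u then 1 else 0) \<partial>lborel)" .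
  qed
  also have "\<dots> = ennreal (2 * pi) * (\<integral>\<^sup>+u. (\<integral>\<^sup>+v. (if 0 \<le> v \<and> v \<le> a \<and> v < u then 1 else 0) \<partial>lborel) \<partial>E)"
    by (rule nn_integral_cmult) measurable
  also have "(\<integral>\<^sup>+u. (\<integral>\<^sup>+v. (if 0 \<le> v \<and> v \<le> a \<and> v < u then 1 else 0) \<partial>lborel) \<partial>E) =
    (\<integral>\<^sup>+v. (\<integral>\<^sup>+u. (if 0 \<le> v \<and> v \<le> a \<and> v < u then 1 else 0) \<partial>E) \<partial>lborel)"
  proof -
    interpret P2: pair_sigma_finite "lborel :: real measure" E
      unfolding E_def pair_sigma_finite_def using E.sigma_finite_measure_axioms
      by (simp add: lborel.sigma_finite_measure_axioms)
    show ?thesis by (rule P2.Fubini') measurable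
  qed
  \<comment> \<open>For rate 1 the exponential tail at \<open>v\<close> coincides with the density
    at \<open>v\<close>; the integral is therefore the exponential distribution function.\<close>
  also have "\<dots> = (\<integral>\<^sup>+v. ennreal (exponential_density 1 v) * indicator {..a} v \<partial>lborel)"
  proof (rule nn_integral_cong)
    fix v
    have "(\<integral>\<^sup>+u. (if 0 \<le> v \<and> v \<le> a \<and> v < u then 1 else 0) \<partial>E) = (\<integral>\<^sup>+u. indicator {0..a} v * indicator {v<..} u \<partial>E)"
      by (intro nn_integral_cong) (auto simp: indicator_def)
    also have "\<dots> = indicator {0..a} v * emeasure E {v<..}"
      by (simp add: nn_integral_cmult)
    also have "\<dots> = ennreal (exponential_density 1 v) * indicator {..a} v"
      using emeasure_exponential_greaterThan[of v, folded E_def]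
      by (auto simp: indicator_def exponential_density_def)
    finally show "(\<integral>\<^sup>+u. (if 0 \<le> v \<and> v \<le> a \<and> v < u then 1 else 0) \<partial>E) =
      ennreal (exponential_density 1 v) * indicator {..a} v" .
  qed
  also have "\<dots> = ennreal (1 - exp (- a))"
    using a by (subst nn_integral_erlang_density) (auto simp: erlang_CDF_def)
  finally have "emeasure M {\<omega> \<in> space M. ?q (X \<omega>, Y \<omega>) \<le> a} = ennreal (1 - exp (- a))"
    by (simp add: mult.assoc[symmetric] ennreal_mult'[symmetric])
  then show "emeasure M {\<omega> \<in> space M. ((X \<omega>)\<^sup>2 + (Y \<omega>)\<^sup>2) / 2 \<le> a} = 1 - ennreal (exp (- a * 1))"
    using a by (simp add: ennreal_minus flip: ennreal_1)
qed simp

text \<open>Exponential tilting: multiplied by \<open>exp (a * x)\<close>, the density of rate 1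
  becomes \<open>1 / (1 - a)\<close> times the density of rate \<open>1 - a\<close>, which has mass
  one.\<close>

lemma (in prob_space) nn_integral_exp_exponential:
  assumes D: "distributed M lborel X (exponential_density 1)" and "a < 1"
  shows "(\<integral>\<^sup>+\<omega>. ennreal (exp (a * X \<omega>)) \<partial>M) = ennreal (1 / (1 - a))"
proof -
  interpret E: prob_space "density lborel (exponential_density (1 - a))"
    by (rule prob_space_exponential_density) (use assms in simp)
  have "(\<integral>\<^sup>+\<omega>. ennreal (exp (a * X \<omega>)) \<partial>M) =
      (\<integral>\<^sup>+x. ennreal (exponential_density 1 x) * ennreal (exp (a * x)) \<partial>lborel)"
    by (rule distributed_nn_integral[OF D, symmetric]) simp
  also have "\<dots> = (\<integral>\<^sup>+x. ennreal (1 / (1 - a)) * ennreal (exponential_density (1 - a) x) \<partial>lborel)"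
  proof (rule nn_integral_cong)
    fix x
    have "exponential_density 1 x * exp (a * x) = 1 / (1 - a) * exponential_density (1 - a) x"
      using \<open>a < 1\<close> by (auto simp: exponential_density_def field_simps simp flip: exp_add)
    then show "ennreal (exponential_density 1 x) * ennreal (exp (a * x)) =
        ennreal (1 / (1 - a)) * ennreal (exponential_density (1 - a) x)"
      using \<open>a < 1\<close> by (simp add: exponential_density_nonneg ennreal_mult'[symmetric] ennreal_mult''[symmetric])
  qed
  also have "\<dots> = ennreal (1 / (1 - a)) * (\<integral>\<^sup>+x. ennreal (exponential_density (1 - a) x) \<partial>lborel)"
    by (rule nn_integral_cmult) simp
  also have "(\<integral>\<^sup>+x. ennreal (exponential_density (1 - a) x) \<partial>lborel) = 1"
    using E.emeasure_space_1 by (simp add: emeasure_density)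
  finally show ?thesis by simp
qed

section \<open>Laws of standard complex Gaussian variables\<close>

lemma (in prob_space) complex_gaussian_borel_measurable:
  assumes "complex_gaussian_rv M Z"
  shows "Z \<in> borel_measurable M"
proof -
  have "(\<lambda>\<omega>. Re (c * Z \<omega>)) \<in> borel_measurable M" for c
    using assms by (simp add: complex_gaussian_rv_def gaussian_rv_def)
  from this[of 1] this[of "- \<i>"] show ?thesis
    by (simp add: borel_measurable_complex_iff)
qed

text \<open>A Bochner integral that does not exist has the value 0, so the value 1 in the hypothesis
  already forces integrability of the squared modulus. On a probability space this gives
  integrability of the variable.\<close>

lemma (in prob_space) std_complex_gaussian_integrable:
  assumes Z: "complex_gaussian_rv M Z" and var: "(\<integral>\<omega>. cnj (Z \<omega>) * Z \<omega> \<partial>M) = 1"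
  shows "integrable M (\<lambda>\<omega>. (cmod (Z \<omega>))\<^sup>2)" "(\<integral>\<omega>. (cmod (Z \<omega>))\<^sup>2 \<partial>M) = 1" "integrable M Z"
proof -
  have [measurable]: "Z \<in> borel_measurable M"
    by (rule complex_gaussian_borel_measurable[OF Z])
  have eq: "cnj z * z = of_real ((cmod z)\<^sup>2)" for z
    using complex_norm_square[of z] by (simp add: mult.commute)
  have "integrable M (\<lambda>\<omega>. cnj (Z \<omega>) * Z \<omega>)"
    using var not_integrable_integral_eq by force
  then show int: "integrable M (\<lambda>\<omega>. (cmod (Z \<omega>))\<^sup>2)"
    unfolding eq complex_of_real_integrable_eq .
  show "(\<integral>\<omega>. (cmod (Z \<omega>))\<^sup>2 \<partial>M) = 1"
    using var unfolding eq integral_complex_of_real by simp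
  show "integrable M Z"
  proof (rule Bochner_Integration.integrable_bound)
    show "integrable M (\<lambda>\<omega>. 1 + (cmod (Z \<omega>))\<^sup>2)" using int by simp
    have "cmod z \<le> 1 + (cmod z)\<^sup>2" for z
      using sum_power2_ge_zero[of "cmod z - 1" 0] by (simp add: power2_eq_square algebra_simps) (smt (verit) zero_le_square norm_ge_zero)
    then show "AE \<omega> in M. norm (Z \<omega>) \<le> norm (1 + (cmod (Z \<omega>))\<^sup>2)"
      by (auto simp: abs_of_nonneg)
  qed simp
qed

text \<open>The squared real part of \<open>w\<close> is half of
  \<open>(cmod w)\<^sup>2 + Re (w * w)\<close>. The second term has mean zero for
  \<open>w = c * Z\<close>, so the variance is half the squared modulus of \<open>c\<close>; this
  explains the normalisation 2.\<close>

lemma (in prob_space) std_complex_gaussian_projection: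
  assumes Z: "complex_gaussian_rv M Z"
    and mean: "(\<integral>\<omega>. Z \<omega> \<partial>M) = 0" and sq: "(\<integral>\<omega>. Z \<omega> * Z \<omega> \<partial>M) = 0"
    and var: "(\<integral>\<omega>. cnj (Z \<omega>) * Z \<omega> \<partial>M) = 1"
    and c: "(cmod c)\<^sup>2 = 2"
  shows "distributed M lborel (\<lambda>\<omega>. Re (c * Z \<omega>)) std_normal_density"
proof -
  have [measurable]: "Z \<in> borel_measurable M"
    by (rule complex_gaussian_borel_measurable[OF Z])
  note int = std_complex_gaussian_integrable[OF Z var]
  have int2: "integrable M (\<lambda>\<omega>. Z \<omega> * Z \<omega>)"
    by (rule Bochner_Integration.integrable_bound[OF int(1)]) (auto simp: norm_mult power2_eq_square)
  define V where "V \<omega> = Re (c * Z \<omega>)" for \<omega>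
  have [measurable]: "V \<in> borel_measurable M" unfolding V_def by measurable
  have V1: "(\<integral>\<omega>. V \<omega> \<partial>M) = 0"
    unfolding V_def using int(3) mean by (subst integral_Re) auto
  have sqid: "(Re w)\<^sup>2 = ((cmod w)\<^sup>2 + Re (w * w)) / 2" for w
    unfolding cmod_power2 by (simp add: power2_eq_square)
  have "(V \<omega>)\<^sup>2 = (cmod (Z \<omega>))\<^sup>2 + Re (c * c * (Z \<omega> * Z \<omega>)) / 2" for \<omega>
  proof -
    have "c * Z \<omega> * (c * Z \<omega>) = c * c * (Z \<omega> * Z \<omega>)" by (simp add: mult_ac)
    moreover have "(cmod (c * Z \<omega>))\<^sup>2 = 2 * (cmod (Z \<omega>))\<^sup>2" by (simp add: norm_mult power_mult_distrib c)
    ultimately show ?thesis unfolding V_def sqid by (simp only:) (simp add: add_divide_distrib)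
  qed
  then have "(\<integral>\<omega>. (V \<omega>)\<^sup>2 \<partial>M) = (\<integral>\<omega>. (cmod (Z \<omega>))\<^sup>2 + Re (c * c * (Z \<omega> * Z \<omega>)) / 2 \<partial>M)"
    by presburger
  also have "\<dots> = (\<integral>\<omega>. (cmod (Z \<omega>))\<^sup>2 \<partial>M) + (\<integral>\<omega>. Re (c * c * (Z \<omega> * Z \<omega>)) \<partial>M) / 2"
    using int int2 by (subst Bochner_Integration.integral_add) (auto simp del: times_complex.sel)
  also have "(\<integral>\<omega>. Re (c * c * (Z \<omega> * Z \<omega>)) \<partial>M) = Re (c * c * (\<integral>\<omega>. Z \<omega> * Z \<omega> \<partial>M))"
    using int2 by (subst integral_Re) auto
  finally have V2: "(\<integral>\<omega>. (V \<omega>)\<^sup>2 \<partial>M) = 1" by (simp add: int sq)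
  have "gaussian_rv M V" unfolding V_def using Z by (simp add: complex_gaussian_rv_def)
  then consider (const) m where "AE \<omega> in M. V \<omega> = m"
    | (normal) m \<sigma> where "0 < \<sigma>" "distributed M lborel V (\<lambda>x. ennreal (normal_density m \<sigma> x))"
    unfolding gaussian_rv_def by blast
  then have "distributed M lborel V std_normal_density"
  proof cases
    \<comment> \<open>The degenerate alternative is excluded: mean zero would make the constant 0,
      against second moment 1.\<close>
    case const
    have "(\<integral>\<omega>. V \<omega> \<partial>M) = (\<integral>\<omega>. m \<partial>M)"
      by (rule integral_cong_AE) (use const in auto)
    moreover have "(\<integral>\<omega>. (V \<omega>)\<^sup>2 \<partial>M) = (\<integral>\<omega>. m\<^sup>2 \<partial>M)"
      by (rule integral_cong_AE) (use const in auto)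
    ultimately show ?thesis using V1 V2 by (simp add: prob_space)
  next
    case normal
    have m: "m = 0" using normal_distributed_expectation[OF normal] V1 by simp
    have "\<sigma>\<^sup>2 = 1" using normal_distributed_variance[OF normal] V1 V2 by simp
    then have "\<sigma> = 1" using normal(1) by (simp add: power2_eq_1_iff)
    with m normal(2) show ?thesis by simp
  qed
  then show ?thesis unfolding V_def .
qed

lemma (in prob_space) std_normal_iexp:
  assumes "distributed M lborel X std_normal_density"
  shows "(\<integral>\<omega>. iexp (t * X \<omega>) \<partial>M) = of_real (exp (- t\<^sup>2 / 2))"
proof -
  have "distr M borel X = std_normal_distribution"
    using distributed_distr_eq_density[OF assms] by (simp cong: distr_cong)
  moreover have [measurable]: "X \<in> borel_measurable M"
    using distributed_measurable[OF assms] by simp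
  moreover have "(\<integral>\<omega>. iexp (t * X \<omega>) \<partial>M) = char (distr M borel X) t"
    unfolding char_def by (subst integral_distr) auto
  ultimately show ?thesis by (simp add: char_std_normal_distribution)
qed

text \<open>Put \<open>X = sqrt 2 * Re Z\<close> and \<open>Y = sqrt 2 * Im Z\<close>. Every
  combination of them is a multiple of one standard projection, so their joint characteristic
  function factorises and they are independent; the squared modulus is half the sum of their
  squares.\<close>

lemma (in prob_space) std_complex_gaussian_norm_square:
  assumes Z: "complex_gaussian_rv M Z"
    and mean: "(\<integral>\<omega>. Z \<omega> \<partial>M) = 0" and sq: "(\<integral>\<omega>. Z \<omega> * Z \<omega> \<partial>M) = 0"
    and var: "(\<integral>\<omega>. cnj (Z \<omega>) * Z \<omega> \<partial>M) = 1"
  shows "distributed M lborel (\<lambda>\<omega>. (cmod (Z \<omega>))\<^sup>2) (exponential_density 1)"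
proof -
  have [measurable]: "Z \<in> borel_measurable M"
    by (rule complex_gaussian_borel_measurable[OF Z])
  note std = std_complex_gaussian_projection[OF Z mean sq var]
  define X Y where "X \<omega> = Re (of_real (sqrt 2) * Z \<omega>)" and "Y \<omega> = Re ((- \<i> * of_real (sqrt 2)) * Z \<omega>)" for \<omega>
  have X: "distributed M lborel X std_normal_density" unfolding X_def by (rule std) simp
  have Y: "distributed M lborel Y std_normal_density" unfolding Y_def by (rule std) (simp add: norm_mult)
  have [measurable]: "X \<in> borel_measurable M" "Y \<in> borel_measurable M"
    unfolding X_def Y_def by measurable
  have "indep_var borel X borel Y"
  proof (rule indep_var_of_char)
    fix a b
    have "(\<integral>\<omega>. iexp (a * X \<omega> + b * Y \<omega>) \<partial>M) = of_real (exp (- (a\<^sup>2 + b\<^sup>2) / 2))"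
    proof (cases "a = 0 \<and> b = 0")
      case True
      then show ?thesis by (simp add: prob_space)
    next
      case False
      define \<rho> where "\<rho> = sqrt (a\<^sup>2 + b\<^sup>2)"
      have \<rho>: "\<rho> > 0" "\<rho>\<^sup>2 = a\<^sup>2 + b\<^sup>2"
        using False by (auto simp: \<rho>_def sum_power2_gt_zero_iff)
      \<comment> \<open>The vector \<open>(a, b) / \<rho>\<close> has length one, so
        \<open>c\<close> has squared modulus 2. The minus sign compensates the one in the real part
        of a product.\<close>
      define c where "c = Complex (sqrt 2 * a / \<rho>) (- sqrt 2 * b / \<rho>)"
      have "(cmod c)\<^sup>2 = 2 * (a\<^sup>2 + b\<^sup>2) / \<rho>\<^sup>2"
        by (simp add: c_def cmod_power2 power_divide power_mult_distrib add_divide_distrib distrib_left)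
      then have "(cmod c)\<^sup>2 = 2" using \<rho>(1) unfolding \<rho>(2)[symmetric] by simp
      moreover have "a * X \<omega> + b * Y \<omega> = \<rho> * Re (c * Z \<omega>)" for \<omega>
        using \<rho>(1) by (simp add: X_def Y_def c_def field_simps)
      ultimately show ?thesis
        using std_normal_iexp[OF std, of c \<rho>] \<rho> by simp
    qed
    moreover have "exp (- (a\<^sup>2 + b\<^sup>2) / 2) = exp (- a\<^sup>2 / 2) * exp (- b\<^sup>2 / 2)"
      unfolding exp_add[symmetric] by (simp add: add_divide_distrib diff_divide_distrib)
    ultimately show "(\<integral>\<omega>. iexp (a * X \<omega> + b * Y \<omega>) \<partial>M) = (\<integral>\<omega>. iexp (a * X \<omega>) \<partial>M) * (\<integral>\<omega>. iexp (b * Y \<omega>) \<partial>M)"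
      unfolding std_normal_iexp[OF X] std_normal_iexp[OF Y] by (simp only: of_real_mult)
  qed auto
  from exponential_half_sum_squares[OF X Y this]
  show ?thesis
    by (simp add: X_def Y_def power_mult_distrib cmod_power2 add_divide_distrib)
qed

subsection \<open>Exponential and Erlang variables\<close>

text \<open>By monotone convergence the extended-valued sum has finite integral, hence is finite
  almost everywhere.\<close>

lemma AE_summable_of_summable_integral:
  fixes f :: "nat \<Rightarrow> 'a \<Rightarrow> real"
  assumes int: "\<And>n. integrable M (f n)" and nonneg: "\<And>n \<omega>. 0 \<le> f n \<omega>"
    and sum: "summable (\<lambda>n. \<integral>\<omega>. f n \<omega> \<partial>M)"
  shows "AE \<omega> in M. summable (\<lambda>n. f n \<omega>)"
    and "integrable M (\<lambda>\<omega>. \<Sum>n. f n \<omega>)"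
proof -
  have [measurable]: "f n \<in> borel_measurable M" for n using int[of n] by simp
  have "(\<integral>\<^sup>+\<omega>. (\<Sum>n. ennreal (f n \<omega>)) \<partial>M) = (\<Sum>n. \<integral>\<^sup>+\<omega>. ennreal (f n \<omega>) \<partial>M)"
    by (rule nn_integral_suminf) simp
  also have "\<dots> = (\<Sum>n. ennreal (\<integral>\<omega>. f n \<omega> \<partial>M))"
    by (subst nn_integral_eq_integral) (use int nonneg in auto)
  also have "\<dots> = ennreal (\<Sum>n. \<integral>\<omega>. f n \<omega> \<partial>M)"
    by (rule suminf_ennreal2) (use sum nonneg in auto)
  finally have "(\<integral>\<^sup>+\<omega>. (\<Sum>n. ennreal (f n \<omega>)) \<partial>M) \<noteq> \<infinity>" by simp
  then have "AE \<omega> in M. (\<Sum>n. ennreal (f n \<omega>)) \<noteq> \<infinity>"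
    by (intro nn_integral_PInf_AE) auto
  then show AE: "AE \<omega> in M. summable (\<lambda>n. f n \<omega>)"
    by eventually_elim (auto intro!: summable_suminf_not_top nonneg)
  show "integrable M (\<lambda>\<omega>. \<Sum>n. f n \<omega>)"
    by (rule integrable_suminf[OF int]) (use AE nonneg sum in auto)
qed

section \<open>Threshold shifts and exponential moments\<close>

context prob_space begin

text \<open>The tail at \<open>x\<close> is \<open>exp (- (l * x))\<close> times the polynomial
  \<open>?S x\<close>, which increases with \<open>x\<close> and is at least 1. A downward shift of
  the threshold thus gains only from the exponential, by exactly the factor
  \<open>exp (l * w)\<close>.\<close>

lemma erlang_tail_shift:
  assumes D: "distributed M lborel X (erlang_density k l)"
    and l: "0 < l" and w: "0 \<le> w" and t: "0 \<le> t"
  shows "\<P>(\<omega> in M. t - w < X \<omega>) \<le> exp (l * w) * \<P>(\<omega> in M. t < X \<omega>)"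
    and "0 < \<P>(\<omega> in M. t < X \<omega>)"
proof -
  let ?S = "\<lambda>x. \<Sum>n\<le>k. (l * x) ^ n / fact n"
  have tail: "\<P>(\<omega> in M. x < X \<omega>) = exp (- (l * x)) * ?S x" if "0 \<le> x" for x
    using erlang_distributed_gt[OF D l that] that
    by (simp add: erlang_CDF_def sum_distrib_left mult_ac)
  have one_le: "1 \<le> ?S x" if "0 \<le> x" for x
    using member_le_sum[of 0 "{..k}" "\<lambda>n. (l * x) ^ n / fact n"] that l by simp
  show "0 < \<P>(\<omega> in M. t < X \<omega>)"
    unfolding tail[OF t] using one_le[OF t] by (intro mult_pos_pos) auto
  show "\<P>(\<omega> in M. t - w < X \<omega>) \<le> exp (l * w) * \<P>(\<omega> in M. t < X \<omega>)"
  proof (cases "w \<le> t")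
    case True
    then have tw: "0 \<le> t - w" by simp
    have "?S (t - w) \<le> ?S t"
      by (intro sum_mono divide_right_mono power_mono mult_left_mono) (use True w l in auto)
    then have "exp (l * w) * exp (- (l * t)) * ?S (t - w) \<le> exp (l * w) * exp (- (l * t)) * ?S t"
      by simp
    moreover have "exp (- (l * (t - w))) = exp (l * w) * exp (- (l * t))"
      unfolding exp_add[symmetric] by (simp add: algebra_simps)
    ultimately show ?thesis unfolding tail[OF t] tail[OF tw] by (simp only: mult.assoc)
  next
    \<comment> \<open>The shifted threshold is negative. The left side is at most 1, and the right
      side exceeds 1 because the exponent \<open>l * (w - t)\<close> is positive.\<close>
    case False
    have "1 \<le> exp (l * w) * exp (- (l * t))"
      unfolding exp_add[symmetric] using False l by simp
    also have "\<dots> \<le> exp (l * w) * exp (- (l * t)) * ?S t"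
      using one_le[OF t] by simp
    finally have "1 \<le> exp (l * w) * \<P>(\<omega> in M. t < X \<omega>)"
      by (simp add: tail[OF t] mult.assoc)
    then show ?thesis using prob_le_1 order_trans by blast
  qed
qed

text \<open>
  Conditionally on \<open>V\<close>, shifting the threshold by \<open>w V\<close> costs at most a factor \<open>exp (l * w V)\<close>
  in an Erlang tail.
\<close>

lemma nn_integral_erlang_shift:
  fixes f h w :: "'b \<Rightarrow> real"
  assumes ind: "indep_var S U T V"
    and [measurable]: "f \<in> borel_measurable S" "h \<in> borel_measurable T" "w \<in> borel_measurable T"
    and D: "distributed M lborel (\<lambda>\<omega>. f (U \<omega>)) (erlang_density k l)"
    and l: "0 < l" and r: "0 \<le> r"
    and w: "\<And>v. 0 \<le> w v"
  shows "(\<integral>\<^sup>+\<omega>. ennreal (h (V \<omega>)) * indicator {\<omega>. r < f (U \<omega>) + w (V \<omega>)} \<omega> \<partial>M) \<le>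
    (\<integral>\<^sup>+\<omega>. ennreal (h (V \<omega>)) * ennreal (exp (l * w (V \<omega>))) \<partial>M) *
      emeasure M {\<omega> \<in> space M. r < f (U \<omega>)}"
proof -
  have U[measurable]: "U \<in> measurable M S" and V[measurable]: "V \<in> measurable M T"
    using indep_var_rv1[OF ind] indep_var_rv2[OF ind] by auto
  define DX where "DX = distr M S U"
  define DY where "DY = distr M T V"
  have [measurable_cong]: "sets DX = sets S" "sets DY = sets T" by (simp_all add: DX_def DY_def)
  interpret DX: prob_space DX unfolding DX_def by (rule prob_space_distr) simp
  interpret DY: prob_space DY unfolding DY_def by (rule prob_space_distr) simp
  interpret PP: pair_sigma_finite DX DY ..
  have joint: "DX \<Otimes>\<^sub>M DY = distr M (S \<Otimes>\<^sub>M T) (\<lambda>\<omega>. (U \<omega>, V \<omega>))"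
    using ind unfolding indep_var_distribution_eq DX_def DY_def by simp
  let ?g = "\<lambda>p. ennreal (h (snd p)) * indicator {r<..} (f (fst p) + w (snd p))"
  have tail: "(\<integral>\<^sup>+u. indicator {t<..} (f u) \<partial>DX) = ennreal (\<P>(\<omega> in M. t < f (U \<omega>)))" for t
  proof -
    have "(\<integral>\<^sup>+u. indicator {t<..} (f u) \<partial>DX) = (\<integral>\<^sup>+\<omega>. indicator {t<..} (f (U \<omega>)) \<partial>M)"
      unfolding DX_def by (rule nn_integral_distr) auto
    also have "\<dots> = (\<integral>\<^sup>+\<omega>. indicator {\<omega> \<in> space M. t < f (U \<omega>)} \<omega> \<partial>M)"
      by (intro nn_integral_cong) (simp add: indicator_def)
    finally show ?thesis by (simp add: emeasure_eq_measure)
  qed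
  have "(\<integral>\<^sup>+\<omega>. ennreal (h (V \<omega>)) * indicator {\<omega>. r < f (U \<omega>) + w (V \<omega>)} \<omega> \<partial>M) =
      (\<integral>\<^sup>+\<omega>. ?g (U \<omega>, V \<omega>) \<partial>M)"
    by (intro nn_integral_cong) (simp add: indicator_def)
  also have "\<dots> = (\<integral>\<^sup>+p. ?g p \<partial>(DX \<Otimes>\<^sub>M DY))"
    unfolding joint by (rule nn_integral_distr[symmetric]) auto
  also have "\<dots> = (\<integral>\<^sup>+v. (\<integral>\<^sup>+u. ?g (u, v) \<partial>DX) \<partial>DY)"
    by (rule PP.nn_integral_snd[symmetric]) simp
  also have "\<dots> \<le> (\<integral>\<^sup>+v. ennreal (h v) * ennreal (exp (l * w v)) *
      emeasure M {\<omega> \<in> space M. r < f (U \<omega>)} \<partial>DY)"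
  proof (rule nn_integral_mono)
    fix v assume "v \<in> space DY"
    have "(\<integral>\<^sup>+u. ?g (u, v) \<partial>DX) = (\<integral>\<^sup>+u. ennreal (h v) * indicator {r - w v<..} (f u) \<partial>DX)"
      by (intro nn_integral_cong) (auto simp: indicator_def)
    also have "\<dots> = ennreal (h v) * ennreal (\<P>(\<omega> in M. r - w v < f (U \<omega>)))"
      by (subst nn_integral_cmult) (auto simp: tail)
    also have "\<dots> \<le> ennreal (h v) * ennreal (exp (l * w v) * \<P>(\<omega> in M. r < f (U \<omega>)))"
      by (intro mult_left_mono ennreal_leI erlang_tail_shift[OF D l w r]) auto
    finally show "(\<integral>\<^sup>+u. ?g (u, v) \<partial>DX) \<le>
      ennreal (h v) * ennreal (exp (l * w v)) * emeasure M {\<omega> \<in> space M. r < f (U \<omega>)}"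
      by (simp add: ennreal_mult mult.assoc emeasure_eq_measure)
  qed
  also have "\<dots> = (\<integral>\<^sup>+v. ennreal (h v) * ennreal (exp (l * w v)) \<partial>DY) *
      emeasure M {\<omega> \<in> space M. r < f (U \<omega>)}"
    by (rule nn_integral_multc) simp
  also have "(\<integral>\<^sup>+v. ennreal (h v) * ennreal (exp (l * w v)) \<partial>DY) =
      (\<integral>\<^sup>+\<omega>. ennreal (h (V \<omega>)) * ennreal (exp (l * w (V \<omega>))) \<partial>M)"
    unfolding DY_def by (rule nn_integral_distr) auto
  finally show ?thesis .
qed

text \<open>Independence turns the moment of a partial sum into the product of
  \<open>1 / (1 - a n)\<close>. The uniform bound \<open>q < 1\<close> gives \<open>1 / (1 - a n)
  \<le> 1 + a n / (1 - q) \<le> exp (a n / (1 - q))\<close>, so summability bounds all these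
  products at once and Fatou passes to the limit.\<close>

lemma nn_integral_exp_exponential_series:
  fixes Z :: "nat \<Rightarrow> 'a \<Rightarrow> real"
  assumes D: "\<And>n. distributed M lborel (Z n) (exponential_density 1)"
    and ind: "indep_vars (\<lambda>_. borel) Z UNIV"
    and a: "\<And>n. 0 \<le> a n" "\<And>n. a n \<le> q" "q < 1" "summable a"
    and sum: "AE \<omega> in M. summable (\<lambda>n. a n * Z n \<omega>)"
  shows "(\<integral>\<^sup>+\<omega>. ennreal (exp (\<Sum>n. a n * Z n \<omega>)) \<partial>M) < \<infinity>"
proof -
  have Z[measurable]: "Z n \<in> borel_measurable M" for n
    using D[of n] by (auto dest: distributed_measurable)
  have bound: "(\<integral>\<^sup>+\<omega>. ennreal (exp (\<Sum>n<N. a n * Z n \<omega>)) \<partial>M) \<le> ennreal (exp (suminf a / (1 - q)))" for N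
  proof -
    have "(\<integral>\<^sup>+\<omega>. ennreal (exp (\<Sum>n<N. a n * Z n \<omega>)) \<partial>M) =
        (\<integral>\<^sup>+\<omega>. (\<Prod>n<N. ennreal (exp (a n * Z n \<omega>))) \<partial>M)"
      by (simp add: exp_sum prod_ennreal)
    also have "\<dots> = (\<Prod>n<N. \<integral>\<^sup>+\<omega>. ennreal (exp (a n * Z n \<omega>)) \<partial>M)"
      by (rule indep_vars_nn_integral)
        (auto intro!: indep_vars_compose2[OF indep_vars_subset[OF ind], where Y = "\<lambda>n x. ennreal (exp (a n * x))"])
    also have "\<dots> = (\<Prod>n<N. ennreal (1 / (1 - a n)))"
      by (intro prod.cong refl nn_integral_exp_exponential D) (use a in \<open>meson le_less_trans\<close>)
    also have "\<dots> = ennreal (\<Prod>n<N. 1 / (1 - a n))"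
      by (rule prod_ennreal) (use a in \<open>simp add: le_less_trans[of _ q 1] less_imp_le\<close>)
    also have "\<dots> \<le> ennreal (exp (suminf a / (1 - q)))"
    proof (rule ennreal_leI)
      have "(\<Prod>n<N. 1 / (1 - a n)) \<le> (\<Prod>n<N. exp (a n / (1 - q)))"
      proof (intro prod_mono conjI)
        fix n
        have lt: "a n < 1" using a by (meson le_less_trans)
        then show "0 \<le> 1 / (1 - a n)" by simp
        have "1 / (1 - a n) = 1 + a n / (1 - a n)" using lt by (simp add: field_simps)
        also have "\<dots> \<le> 1 + a n / (1 - q)" using lt a by (intro add_left_mono divide_left_mono) auto
        also have "\<dots> \<le> exp (a n / (1 - q))" by (rule exp_ge_add_one_self)
        finally show "1 / (1 - a n) \<le> exp (a n / (1 - q))" .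
      qed
      also have "\<dots> = exp ((\<Sum>n<N. a n) / (1 - q))"
        by (simp add: exp_sum sum_divide_distrib)
      also have "\<dots> \<le> exp (suminf a / (1 - q))"
        using a by (auto intro!: divide_right_mono sum_le_suminf)
      finally show "(\<Prod>n<N. 1 / (1 - a n)) \<le> exp (suminf a / (1 - q))" .
    qed
    finally show ?thesis .
  qed
  have "(\<integral>\<^sup>+\<omega>. ennreal (exp (\<Sum>n. a n * Z n \<omega>)) \<partial>M) =
      (\<integral>\<^sup>+\<omega>. liminf (\<lambda>N. ennreal (exp (\<Sum>n<N. a n * Z n \<omega>))) \<partial>M)"
  proof (rule nn_integral_cong_AE, use sum in eventually_elim)
    fix \<omega> assume "summable (\<lambda>n. a n * Z n \<omega>)"
    then have "(\<lambda>N. ennreal (exp (\<Sum>n<N. a n * Z n \<omega>))) \<longlonglongrightarrow> ennreal (exp (\<Sum>n. a n * Z n \<omega>))"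
      by (intro tendsto_ennrealI tendsto_exp summable_LIMSEQ)
    then show "ennreal (exp (\<Sum>n. a n * Z n \<omega>)) = liminf (\<lambda>N. ennreal (exp (\<Sum>n<N. a n * Z n \<omega>)))"
      using lim_imp_Liminf[OF sequentially_bot] by metis
  qed
  also have "\<dots> \<le> liminf (\<lambda>N. \<integral>\<^sup>+\<omega>. ennreal (exp (\<Sum>n<N. a n * Z n \<omega>)) \<partial>M)"
    by (rule nn_integral_liminf) simp
  also have "\<dots> \<le> ennreal (exp (suminf a / (1 - q)))"
    by (rule order_trans[OF Liminf_mono[of _ "\<lambda>_. ennreal (exp (suminf a / (1 - q)))"]])
      (auto simp: bound Liminf_const)
  finally show ?thesis by (simp add: le_less_trans)
qed

end

subsection \<open>Weighted and orthonormal series\<close>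

lemma borel_measurable_cnj [measurable (raw)]:
  "f \<in> borel_measurable M \<Longrightarrow> (\<lambda>x. cnj (f x)) \<in> borel_measurable M"
  by (rule borel_measurable_continuous_on[where f = cnj]) (auto intro: continuous_intros)

lemma mult_le_sum_squares:
  fixes a b :: real
  assumes "0 \<le> a" "0 \<le> b"
  shows "a * b \<le> a\<^sup>2 + b\<^sup>2"
  using sum_squares_bound[of a b] mult_nonneg_nonneg[OF assms] by linarith

lemma weighted_Cauchy_Schwarz_partial:
  fixes a b w :: "nat \<Rightarrow> real"
  assumes w: "\<And>n. 0 \<le> w n"
    and a: "summable (\<lambda>n. w n * (a n)\<^sup>2)" and b: "summable (\<lambda>n. w n * (b n)\<^sup>2)"
  shows "(\<Sum>n\<in>{..<N}. w n * a n * b n)\<^sup>2 \<le> (\<Sum>n. w n * (a n)\<^sup>2) * (\<Sum>n. w n * (b n)\<^sup>2)"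
proof -
  have "(\<Sum>n\<in>{..<N}. w n * a n * b n)\<^sup>2 = (\<Sum>n\<in>{..<N}. (sqrt (w n) * a n) * (sqrt (w n) * b n))\<^sup>2"
    by (intro arg_cong[where f = "\<lambda>x. x\<^sup>2"] sum.cong refl) (use w in simp)
  also have "\<dots> \<le> (\<Sum>n\<in>{..<N}. (sqrt (w n) * a n)\<^sup>2) * (\<Sum>n\<in>{..<N}. (sqrt (w n) * b n)\<^sup>2)"
    by (rule Cauchy_Schwarz_ineq_sum)
  also have "\<dots> = (\<Sum>n\<in>{..<N}. w n * (a n)\<^sup>2) * (\<Sum>n\<in>{..<N}. w n * (b n)\<^sup>2)"
    using w by (simp add: power_mult_distrib)
  also have "\<dots> \<le> (\<Sum>n. w n * (a n)\<^sup>2) * (\<Sum>n. w n * (b n)\<^sup>2)"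
    by (intro mult_mono sum_le_suminf a b sum_nonneg suminf_nonneg) (auto simp: w)
  finally show ?thesis .
qed

text \<open>Cauchy-Schwarz applied to the moduli bounds all absolute partial sums, which gives
  convergence as well. The bound for finite sums is kept because it serves as the dominating
  function in later limit theorems; \<open>B\<close> replaces the sum over \<open>e\<close> so that
  the bound is the same at every point.\<close>

lemma weighted_series_bounds:
  fixes s e :: "nat \<Rightarrow> complex" and w :: "nat \<Rightarrow> real"
  assumes w: "\<And>n. 0 \<le> w n"
    and s: "summable (\<lambda>n. w n * (cmod (s n))\<^sup>2)" and e: "summable (\<lambda>n. w n * (cmod (e n))\<^sup>2)"
    and B: "(\<Sum>n. w n * (cmod (e n))\<^sup>2) \<le> B"
  shows "summable (\<lambda>n. s n * of_real (w n) * e n)"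
    and "cmod (\<Sum>n<N. s n * of_real (w n) * e n) \<le> sqrt (B * (\<Sum>n. w n * (cmod (s n))\<^sup>2))"
    and "cmod (\<Sum>n. s n * of_real (w n) * e n) \<le> sqrt (B * (\<Sum>n. w n * (cmod (s n))\<^sup>2))"
proof -
  let ?K = "sqrt (B * (\<Sum>n. w n * (cmod (s n))\<^sup>2))"
  have norm_eq: "cmod (s n * of_real (w n) * e n) = w n * cmod (s n) * cmod (e n)" for n
    using w[of n] by (simp add: norm_mult)
  have part: "(\<Sum>n<N. cmod (s n * of_real (w n) * e n)) \<le> ?K" for N
  proof (rule real_le_rsqrt)
    have "(\<Sum>n<N. cmod (s n * of_real (w n) * e n))\<^sup>2 \<le>
        (\<Sum>n. w n * (cmod (s n))\<^sup>2) * (\<Sum>n. w n * (cmod (e n))\<^sup>2)"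
      unfolding norm_eq by (rule weighted_Cauchy_Schwarz_partial[OF w s e])
    also have "\<dots> \<le> (\<Sum>n. w n * (cmod (s n))\<^sup>2) * B"
      by (intro mult_left_mono B suminf_nonneg s) (use w in auto)
    finally show "(\<Sum>n<N. cmod (s n * of_real (w n) * e n))\<^sup>2 \<le> B * (\<Sum>n. w n * (cmod (s n))\<^sup>2)"
      by (simp add: mult.commute)
  qed
  have sn: "summable (\<lambda>n. cmod (s n * of_real (w n) * e n))"
    by (rule summableI_nonneg_bounded[of _ ?K]) (use part in auto)
  then show "summable (\<lambda>n. s n * of_real (w n) * e n)" by (rule summable_norm_cancel)
  show "cmod (\<Sum>n<N. s n * of_real (w n) * e n) \<le> ?K"
    using norm_sum part by (rule order_trans)
  show "cmod (\<Sum>n. s n * of_real (w n) * e n) \<le> ?K"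
    using summable_norm[OF sn] suminf_le_const[OF sn part] by linarith
qed

text \<open>Pythagoras: the squared modulus is expanded as a complex double sum, of which only the
  diagonal survives.\<close>

lemma has_bochner_integral_orthonormal_sum:
  fixes e :: "nat \<Rightarrow> 'a \<Rightarrow> complex" and c :: "nat \<Rightarrow> complex"
  assumes [measurable]: "\<And>n. e n \<in> borel_measurable N"
    and sq: "\<And>n. integrable N (\<lambda>x. (cmod (e n x))\<^sup>2)"
    and on: "\<And>m n. (\<integral>x. cnj (e m x) * e n x \<partial>N) = (if m = n then 1 else 0)"
  shows "has_bochner_integral N (\<lambda>x. (cmod (\<Sum>n<k. c n * e n x))\<^sup>2) (\<Sum>n<k. (cmod (c n))\<^sup>2)"
proof -
  have int: "integrable N (\<lambda>x. cnj (e m x) * e n x)" for m n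
  proof (rule Bochner_Integration.integrable_bound)
    show "integrable N (\<lambda>x. (cmod (e m x))\<^sup>2 + (cmod (e n x))\<^sup>2)" using sq by simp
    show "AE x in N. norm (cnj (e m x) * e n x) \<le> norm ((cmod (e m x))\<^sup>2 + (cmod (e n x))\<^sup>2)"
      by (auto simp: norm_mult intro!: mult_le_sum_squares)
  qed simp
  have eq: "complex_of_real ((cmod (\<Sum>n<k. c n * e n x))\<^sup>2) =
      (\<Sum>m<k. \<Sum>n<k. cnj (c m) * c n * (cnj (e m x) * e n x))" for x
  proof -
    have "complex_of_real ((cmod (\<Sum>n<k. c n * e n x))\<^sup>2) = cnj (\<Sum>m<k. c m * e m x) * (\<Sum>n<k. c n * e n x)"
      using complex_norm_square[of "\<Sum>n<k. c n * e n x"] by (simp add: mult.commute)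
    also have "\<dots> = (\<Sum>m<k. \<Sum>n<k. cnj (c m) * c n * (cnj (e m x) * e n x))"
      unfolding cnj_sum sum_product by (intro sum.cong refl) (simp add: mult_ac)
    finally show ?thesis .
  qed
  have "has_bochner_integral N (\<lambda>x. \<Sum>m<k. \<Sum>n<k. cnj (c m) * c n * (cnj (e m x) * e n x))
      (\<Sum>m<k. \<Sum>n<k. cnj (c m) * c n * (\<integral>x. cnj (e m x) * e n x \<partial>N))"
    by (intro has_bochner_integral_sum has_bochner_integral_mult_right has_bochner_integral_integrable int)
  also have "(\<Sum>m<k. \<Sum>n<k. cnj (c m) * c n * (\<integral>x. cnj (e m x) * e n x \<partial>N)) =
      (\<Sum>m<k. complex_of_real ((cmod (c m))\<^sup>2))"
  proof (rule sum.cong)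
    fix m assume "m \<in> {..<k}"
    then have "(\<Sum>n<k. cnj (c m) * c n * (\<integral>x. cnj (e m x) * e n x \<partial>N)) = cnj (c m) * c m"
      unfolding on by (subst sum.remove[of _ m]) (auto intro!: sum.neutral)
    then show "(\<Sum>n<k. cnj (c m) * c n * (\<integral>x. cnj (e m x) * e n x \<partial>N)) = complex_of_real ((cmod (c m))\<^sup>2)"
      using complex_norm_square[of "c m"] by (simp add: mult.commute)
  qed simp
  finally have "has_bochner_integral N (\<lambda>x. complex_of_real ((cmod (\<Sum>n<k. c n * e n x))\<^sup>2))
      (\<Sum>m<k. complex_of_real ((cmod (c m))\<^sup>2))"
    unfolding eq .
  from has_bochner_integral_Re[OF this] show ?thesis by simp
qed

text \<open>Parseval for a series that converges pointwise. On a finite measure space a uniform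
  bound on the partial sums allows dominated convergence, so no completeness of \<open>L2\<close> is
  involved.\<close>

lemma (in finite_measure) orthonormal_series_integral:
  fixes e :: "nat \<Rightarrow> 'a \<Rightarrow> complex" and c :: "nat \<Rightarrow> complex"
  assumes [measurable]: "\<And>n. e n \<in> borel_measurable M"
    and sq: "\<And>n. integrable M (\<lambda>x. (cmod (e n x))\<^sup>2)"
    and on: "\<And>m n. (\<integral>x. cnj (e m x) * e n x \<partial>M) = (if m = n then 1 else 0)"
    and bd: "\<And>k x. x \<in> space M \<Longrightarrow> cmod (\<Sum>n<k. c n * e n x) \<le> K"
    and F: "\<And>x. x \<in> space M \<Longrightarrow> (\<lambda>n. c n * e n x) sums F x"
  shows "(\<lambda>n. (cmod (c n))\<^sup>2) sums (\<integral>x. (cmod (F x))\<^sup>2 \<partial>M)"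
proof -
  note hbi = has_bochner_integral_orthonormal_sum[OF assms(1) sq on, of c]
  have lim: "(\<lambda>k. \<Sum>n<k. c n * e n x) \<longlonglongrightarrow> F x" if "x \<in> space M" for x
    using F[OF that] by (simp add: sums_def)
  have [measurable]: "F \<in> borel_measurable M"
    by (rule borel_measurable_LIMSEQ_metric[OF _ lim]) auto
  have "(\<lambda>k. \<integral>x. (cmod (\<Sum>n<k. c n * e n x))\<^sup>2 \<partial>M) \<longlonglongrightarrow> (\<integral>x. (cmod (F x))\<^sup>2 \<partial>M)"
  proof (rule integral_dominated_convergence)
    show "integrable M (\<lambda>x. K\<^sup>2)" by simp
    show "AE x in M. (\<lambda>k. (cmod (\<Sum>n<k. c n * e n x))\<^sup>2) \<longlonglongrightarrow> (cmod (F x))\<^sup>2"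
      by (intro AE_I2 tendsto_power tendsto_norm lim)
    show "AE x in M. norm ((cmod (\<Sum>n<k. c n * e n x))\<^sup>2) \<le> K\<^sup>2" for k
      by (intro AE_I2) (auto intro!: power_mono bd)
  qed auto
  then show ?thesis
    unfolding sums_def has_bochner_integral_integral_eq[OF hbi] .
qed

text \<open>Each \<open>e n\<close> has norm one, so each \<open>\<mu> n\<close> is an eigenvalue
  and at most \<kappa>. If \<kappa> were missing from the list, the spanning clause would be an
  empty sum and its eigenfunctions would vanish. Convergence to 0 makes the multiplicity finite and
  monotonicity makes the indices an initial segment; counting from 0, the first eigenvalue below the
  top has index \<open>g\<close>.\<close>

lemma spectral_system_top:
  assumes sp: "spectral_system \<Lambda> C \<mu> e" and top: "largest_eigenvalue \<Lambda> C \<kappa>" and pos: "0 < \<kappa>"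
  defines "g \<equiv> card {n. \<mu> n = \<kappa>}"
  shows "{n. \<mu> n = \<kappa>} = {..<g}" "0 < g" "\<And>n. \<mu> n \<le> \<kappa>" "\<mu> g < \<kappa>"
proof -
  have dec: "decseq \<mu>" and lim: "\<mu> \<longlonglongrightarrow> 0"
    and es: "\<And>n. e n \<in> eigenspace \<Lambda> C (of_real (\<mu> n))"
    and on: "\<And>n. L2_inner \<Lambda> (e n) (e n) = 1"
    and span: "\<And>\<kappa> f. \<kappa> \<noteq> 0 \<Longrightarrow> f \<in> eigenspace \<Lambda> C \<kappa> \<Longrightarrow>
        (\<exists>c. AE x in lebesgue_on \<Lambda>. f x = (\<Sum>n\<in>{n. of_real (\<mu> n) = \<kappa>}. c n * e n x))"
    using sp unfolding spectral_system_def by auto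
  have nz: "\<not> (AE x in lebesgue_on \<Lambda>. e n x = 0)" for n
  proof
    assume "AE x in lebesgue_on \<Lambda>. e n x = 0"
    then have "L2_inner \<Lambda> (e n) (e n) = (\<integral>x. 0 \<partial>lebesgue_on \<Lambda>)"
      unfolding L2_inner_def using es[of n]
      by (intro integral_cong_AE) (auto simp: eigenspace_def L2_def)
    then show False using on[of n] by simp
  qed
  show le: "\<mu> n \<le> \<kappa>" for n
    using top es[of n] nz[of n] unfolding largest_eigenvalue_def eigenvalue_def by blast
  have ne: "{n. \<mu> n = \<kappa>} \<noteq> {}"
  proof
    assume empty: "{n. \<mu> n = \<kappa>} = {}"
    obtain f where f: "f \<in> eigenspace \<Lambda> C (of_real \<kappa>)" "\<not> (AE x in lebesgue_on \<Lambda>. f x = 0)"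
      using top unfolding largest_eigenvalue_def eigenvalue_def by blast
    have "{n. complex_of_real (\<mu> n) = of_real \<kappa>} = {}" using empty by auto
    then have "AE x in lebesgue_on \<Lambda>. f x = 0"
      using span[OF _ f(1)] pos by simp
    with f(2) show False ..
  qed
  have fin: "finite {n. \<mu> n = \<kappa>}"
  proof -
    have "\<forall>\<^sub>F n in sequentially. \<mu> n < \<kappa>" using order_tendstoD(2)[OF lim pos] .
    then obtain k where "\<And>n. n \<ge> k \<Longrightarrow> \<mu> n < \<kappa>" unfolding eventually_sequentially by blast
    then have "{n. \<mu> n = \<kappa>} \<subseteq> {..<k}" by (force simp: not_less[symmetric])
    then show ?thesis by (rule finite_subset) simp
  qed
  have down: "\<mu> m = \<kappa>" if "\<mu> n = \<kappa>" "m \<le> n" for m n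
    using decseqD[OF dec that(2)] le[of m] that(1) by simp
  show eq: "{n. \<mu> n = \<kappa>} = {..<g}"
  proof -
    define k where "k = Max {n. \<mu> n = \<kappa>}"
    have "\<mu> k = \<kappa>" using Max_in[OF fin ne] by (simp add: k_def)
    have "{n. \<mu> n = \<kappa>} = {..k}"
    proof (intro equalityI subsetI)
      show "n \<in> {..k}" if "n \<in> {n. \<mu> n = \<kappa>}" for n
        using Max_ge[OF fin that] by (simp add: k_def)
      show "n \<in> {n. \<mu> n = \<kappa>}" if "n \<in> {..k}" for n
        using down[OF \<open>\<mu> k = \<kappa>\<close>, of n] that by simp
    qed
    then show ?thesis unfolding g_def by (simp add: lessThan_Suc_atMost)
  qed
  have "{..<g} \<noteq> {}" using ne unfolding eq .
  then show "0 < g" by auto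
  have "g \<notin> {n. \<mu> n = \<kappa>}" unfolding eq by simp
  then show "\<mu> g < \<kappa>" using le[of g] by simp
qed

subsection \<open>The Karhunen--Loeve expansion\<close>

locale kl_field = prob_space M for M :: "'w measure" +
  fixes \<Lambda> :: "(real ^ 'd) set" and C :: "(real ^ 'd) \<Rightarrow> (real ^ 'd) \<Rightarrow> complex"
    and \<phi> :: "(real ^ 'd) \<Rightarrow> 'w \<Rightarrow> complex" and \<mu> :: "nat \<Rightarrow> real"
    and e :: "nat \<Rightarrow> (real ^ 'd) \<Rightarrow> complex" and s :: "nat \<Rightarrow> 'w \<Rightarrow> complex" and B :: real
  assumes bounded: "bounded \<Lambda>" and meas: "\<Lambda> \<in> sets lebesgue"
    and \<phi>_measurable: "\<And>x. x \<in> \<Lambda> \<Longrightarrow> \<phi> x \<in> borel_measurable M"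
    and spectral: "spectral_system \<Lambda> C \<mu> e"
    and iid: "iid_std_complex_gaussian M s"
    and KL: "\<And>x. x \<in> \<Lambda> \<Longrightarrow> AE \<omega> in M. (\<lambda>n. s n \<omega> * of_real (sqrt (\<mu> n)) * e n x) sums \<phi> x \<omega>"
    and cont: "AE \<omega> in M. continuous_on \<Lambda> (\<lambda>x. \<phi> x \<omega>)"
    and summable_e: "\<And>x. x \<in> \<Lambda> \<Longrightarrow> summable (\<lambda>n. sqrt (\<mu> n) * (cmod (e n x))\<^sup>2)"
    and B: "\<And>x. x \<in> \<Lambda> \<Longrightarrow> (\<Sum>n. sqrt (\<mu> n) * (cmod (e n x))\<^sup>2) \<le> B"
    and B_nonneg: "0 \<le> B"
begin

definition Z :: "nat \<Rightarrow> 'w \<Rightarrow> real" where "Z n \<omega> = (cmod (s n \<omega>))\<^sup>2"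

definition S :: "'w \<Rightarrow> real" where "S \<omega> = (\<Sum>n. sqrt (\<mu> n) * Z n \<omega>)"

lemma Z_nonneg [simp]: "0 \<le> Z n \<omega>"
  by (simp add: Z_def)

lemma mu_nonneg [simp]: "0 \<le> \<mu> n" and mu_decseq: "decseq \<mu>"
  using spectral by (auto simp: spectral_system_def)

lemma e_L2: "e n \<in> L2 \<Lambda>"
  using spectral by (simp add: spectral_system_def eigenspace_def)

lemma e_measurable [measurable]: "e n \<in> borel_measurable (lebesgue_on \<Lambda>)"
  and e_square_integrable: "integrable (lebesgue_on \<Lambda>) (\<lambda>x. (cmod (e n x))\<^sup>2)"
  using e_L2[of n] by (auto simp: L2_def)

lemma e_orthonormal: "(\<integral>x. cnj (e m x) * e n x \<partial>lebesgue_on \<Lambda>) = (if m = n then 1 else 0)"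
  using spectral by (simp add: spectral_system_def L2_inner_def)

sublocale Leb: finite_measure "lebesgue_on \<Lambda>"
proof
  have "\<Lambda> \<in> lmeasurable" using bounded meas by (rule bounded_set_imp_lmeasurable)
  then have "emeasure lebesgue \<Lambda> < \<infinity>" by (simp only: fmeasurable_def mem_Collect_eq infinity_ennreal_def)
  then show "emeasure (lebesgue_on \<Lambda>) (space (lebesgue_on \<Lambda>)) \<noteq> \<infinity>"
    using meas by (simp add: emeasure_restrict_space del: emeasure_completion)
qed

lemma space_Leb [simp]: "space (lebesgue_on \<Lambda>) = \<Lambda>"
  using meas by simp

text \<open>Integrate the bound on the diagonal of the square root of the covariance over \<open>\<Lambda>\<close>.\<close>

lemma summable_sqrt_mu: "summable (\<lambda>n. sqrt (\<mu> n))"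
proof (rule summableI_nonneg_bounded)
  fix N
  have one: "(\<integral>x. (cmod (e n x))\<^sup>2 \<partial>lebesgue_on \<Lambda>) = 1" for n
  proof -
    have "(\<integral>x. cnj (e n x) * e n x \<partial>lebesgue_on \<Lambda>) = (\<integral>x. complex_of_real ((cmod (e n x))\<^sup>2) \<partial>lebesgue_on \<Lambda>)"
      by (rule Bochner_Integration.integral_cong[OF refl]) (metis complex_norm_square mult.commute)
    then have "complex_of_real (\<integral>x. (cmod (e n x))\<^sup>2 \<partial>lebesgue_on \<Lambda>) = 1"
      unfolding integral_complex_of_real e_orthonormal by simp
    then show ?thesis unfolding of_real_eq_1_iff .
  qed
  have "(\<Sum>n<N. sqrt (\<mu> n)) = (\<integral>x. (\<Sum>n<N. sqrt (\<mu> n) * (cmod (e n x))\<^sup>2) \<partial>lebesgue_on \<Lambda>)"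
    using e_square_integrable by (simp add: one)
  also have "\<dots> \<le> (\<integral>x. B \<partial>lebesgue_on \<Lambda>)"
  proof (rule integral_mono_AE)
    show "AE x in lebesgue_on \<Lambda>. (\<Sum>n<N. sqrt (\<mu> n) * (cmod (e n x))\<^sup>2) \<le> B"
    proof (rule AE_I2)
      fix x assume "x \<in> space (lebesgue_on \<Lambda>)"
      then have x: "x \<in> \<Lambda>" by simp
      have "(\<Sum>n<N. sqrt (\<mu> n) * (cmod (e n x))\<^sup>2) \<le> (\<Sum>n. sqrt (\<mu> n) * (cmod (e n x))\<^sup>2)"
        by (rule sum_le_suminf[OF summable_e[OF x]]) auto
      then show "(\<Sum>n<N. sqrt (\<mu> n) * (cmod (e n x))\<^sup>2) \<le> B" using B[OF x] by simp
    qed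
  qed (use e_square_integrable in auto)
  finally show "(\<Sum>n<N. sqrt (\<mu> n)) \<le> (\<integral>x. B \<partial>lebesgue_on \<Lambda>)" .
qed simp

section \<open>The random coefficients and their squared moduli\<close>

lemma s_indep: "indep_vars (\<lambda>_. borel) s UNIV"
  and s_gaussian: "complex_gaussian_rv M (s n)"
  and s_mean: "(\<integral>\<omega>. s n \<omega> \<partial>M) = 0"
  and s_pseudo: "(\<integral>\<omega>. s n \<omega> * s m \<omega> \<partial>M) = 0"
  and s_cov: "(\<integral>\<omega>. cnj (s n \<omega>) * s m \<omega> \<partial>M) = (if n = m then 1 else 0)"
  using iid by (simp_all add: iid_std_complex_gaussian_def)

lemma s_measurable [measurable]: "s n \<in> borel_measurable M"
  by (rule complex_gaussian_borel_measurable[OF s_gaussian])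

lemma Z_measurable [measurable]: "Z n \<in> borel_measurable M"
  unfolding Z_def by measurable

lemma S_measurable [measurable]: "S \<in> borel_measurable M"
  unfolding S_def by measurable

lemma Z_integrable: "integrable M (Z n)" and Z_expectation: "(\<integral>\<omega>. Z n \<omega> \<partial>M) = 1"
  unfolding Z_def using std_complex_gaussian_integrable[OF s_gaussian, of n] s_cov[of n n] by auto

lemma Z_exponential: "distributed M lborel (Z n) (exponential_density 1)"
  unfolding Z_def
  by (rule std_complex_gaussian_norm_square) (auto simp: s_gaussian s_mean s_pseudo s_cov)

lemma Z_indep: "indep_vars (\<lambda>_. borel) Z UNIV"
  unfolding Z_def by (rule indep_vars_compose2[OF s_indep]) simp

lemma summable_Z: "AE \<omega> in M. summable (\<lambda>n. sqrt (\<mu> n) * Z n \<omega>)"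
  and S_integrable: "integrable M S"
  unfolding S_def
  by (rule AE_summable_of_summable_integral;
      use summable_sqrt_mu Z_integrable in \<open>simp add: Z_expectation\<close>)+

section \<open>One null set for the whole domain\<close>

text \<open>Only countably many null sets can be merged, so the expansion is first secured on a
  countable dense set. Taking it inside \<Lambda> lets continuity on \<Lambda> carry statements to
  the remaining points.\<close>

lemma KL_dense:
  obtains D where "countable D" "D \<subseteq> \<Lambda>" "\<Lambda> \<subseteq> closure D"
    "AE \<omega> in M. \<forall>x\<in>D. (\<lambda>n. s n \<omega> * of_real (sqrt (\<mu> n)) * e n x) sums \<phi> x \<omega>"
proof -
  obtain D where D: "countable D" "D \<subseteq> \<Lambda>" "\<Lambda> \<subseteq> closure D"
    by (rule separable)
  moreover have "AE \<omega> in M. \<forall>x\<in>D. (\<lambda>n. s n \<omega> * of_real (sqrt (\<mu> n)) * e n x) sums \<phi> x \<omega>"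
    using D KL by (auto simp: AE_ball_countable)
  ultimately show ?thesis using that by blast
qed

lemma KL_bounds:
  assumes "summable (\<lambda>n. sqrt (\<mu> n) * Z n \<omega>)" and "x \<in> \<Lambda>"
  shows "summable (\<lambda>n. s n \<omega> * of_real (sqrt (\<mu> n)) * e n x)"
    and "cmod (\<Sum>n<N. s n \<omega> * of_real (sqrt (\<mu> n)) * e n x) \<le> sqrt (B * S \<omega>)"
    and "cmod (\<Sum>n. s n \<omega> * of_real (sqrt (\<mu> n)) * e n x) \<le> sqrt (B * S \<omega>)"
proof -
  have sum: "summable (\<lambda>n. sqrt (\<mu> n) * (cmod (s n \<omega>))\<^sup>2)"
    using assms(1) unfolding Z_def .
  have nonneg: "0 \<le> sqrt (\<mu> n)" for n by simp
  note bounds = weighted_series_bounds[where w = "\<lambda>n. sqrt (\<mu> n)" and s = "\<lambda>n. s n \<omega>"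
    and e = "\<lambda>n. e n x" and B = B, OF nonneg sum summable_e[OF assms(2)] B[OF assms(2)]]
  show "summable (\<lambda>n. s n \<omega> * of_real (sqrt (\<mu> n)) * e n x)" by (fact bounds(1))
  show "cmod (\<Sum>n<N. s n \<omega> * of_real (sqrt (\<mu> n)) * e n x) \<le> sqrt (B * S \<omega>)"
    unfolding S_def Z_def by (fact bounds(2))
  show "cmod (\<Sum>n. s n \<omega> * of_real (sqrt (\<mu> n)) * e n x) \<le> sqrt (B * S \<omega>)"
    unfolding S_def Z_def by (fact bounds(3))
qed

text \<open>Dropping initial terms can only lower the diagonal sum, so the same \<open>B\<close>
  serves every tail. All dependence on \<open>k\<close> sits in the random factor, whence
  convergence uniform in the point.\<close>

lemma KL_tail_bound:
  assumes Z: "summable (\<lambda>n. sqrt (\<mu> n) * Z n \<omega>)" and x: "x \<in> \<Lambda>"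
  shows "cmod (\<Sum>n. s (n + k) \<omega> * of_real (sqrt (\<mu> (n + k))) * e (n + k) x) \<le>
    sqrt (B * (\<Sum>n. sqrt (\<mu> (n + k)) * Z (n + k) \<omega>))"
  unfolding Z_def
proof (rule weighted_series_bounds(3))
  show "summable (\<lambda>n. sqrt (\<mu> (n + k)) * (cmod (s (n + k) \<omega>))\<^sup>2)"
    using summable_ignore_initial_segment[OF Z, of k] by (simp add: Z_def)
  show sum: "summable (\<lambda>n. sqrt (\<mu> (n + k)) * (cmod (e (n + k) x))\<^sup>2)"
    using summable_ignore_initial_segment[OF summable_e[OF x], of k] by simp
  have "(\<Sum>n. sqrt (\<mu> n) * (cmod (e n x))\<^sup>2) = (\<Sum>n. sqrt (\<mu> (n + k)) * (cmod (e (n + k) x))\<^sup>2) +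
      (\<Sum>n<k. sqrt (\<mu> n) * (cmod (e n x))\<^sup>2)"
    by (rule suminf_split_initial_segment[OF summable_e[OF x]])
  moreover have "0 \<le> (\<Sum>n<k. sqrt (\<mu> n) * (cmod (e n x))\<^sup>2)" by (intro sum_nonneg) simp
  ultimately show "(\<Sum>n. sqrt (\<mu> (n + k)) * (cmod (e (n + k) x))\<^sup>2) \<le> B"
    using B[OF x] by linarith
qed simp

text \<open>The series bound holds on the dense set and extends by continuity of the path. It is
  proved before the expansion is known everywhere, because that proof uses continuity of the
  eigenfunctions, which in turn rests on this domination.\<close>

lemma \<phi>_bound: "AE \<omega> in M. \<forall>x\<in>\<Lambda>. cmod (\<phi> x \<omega>) \<le> sqrt (B * S \<omega>)"
proof -
  obtain D where "countable D" and D: "D \<subseteq> \<Lambda>" "\<Lambda> \<subseteq> closure D"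
    and sums: "AE \<omega> in M. \<forall>x\<in>D. (\<lambda>n. s n \<omega> * of_real (sqrt (\<mu> n)) * e n x) sums \<phi> x \<omega>"
    by (rule KL_dense)
  from sums cont summable_Z show ?thesis
  proof eventually_elim
    fix \<omega> assume sums: "\<forall>x\<in>D. (\<lambda>n. s n \<omega> * of_real (sqrt (\<mu> n)) * e n x) sums \<phi> x \<omega>"
      and cont: "continuous_on \<Lambda> (\<lambda>x. \<phi> x \<omega>)" and Z: "summable (\<lambda>n. sqrt (\<mu> n) * Z n \<omega>)"
    have bd: "cmod (\<phi> x \<omega>) \<le> sqrt (B * S \<omega>)" if "x \<in> D" for x
    proof -
      have "\<phi> x \<omega> = (\<Sum>n. s n \<omega> * of_real (sqrt (\<mu> n)) * e n x)"
        using bspec[OF sums that] by (rule sums_unique)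
      then show ?thesis using KL_bounds(3)[OF Z subsetD[OF D(1) that]] by simp
    qed
    show "\<forall>x\<in>\<Lambda>. cmod (\<phi> x \<omega>) \<le> sqrt (B * S \<omega>)"
    proof
      fix x assume x: "x \<in> \<Lambda>"
      then have "x \<in> closure D" using D(2) by blast
      then obtain d where d: "\<And>n. d n \<in> D" "d \<longlonglongrightarrow> x"
        unfolding closure_sequential by blast
      have "d n \<in> \<Lambda>" for n using d(1) D(1) by blast
      then have "(\<lambda>n. cmod (\<phi> (d n) \<omega>)) \<longlonglongrightarrow> cmod (\<phi> x \<omega>)"
        by (intro tendsto_norm continuous_on_tendsto_compose[OF cont d(2) x]) simp
      then show "cmod (\<phi> x \<omega>) \<le> sqrt (B * S \<omega>)"
        by (rule LIMSEQ_le_const2) (use bd d(1) in blast)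
    qed
  qed
qed

text \<open>An integrable majorant for \<open>cnj (s n)\<close> times the field or a partial sum of
  it, the second factor being bounded by \<open>sqrt (B * S \<omega>)\<close>.\<close>

lemma Z_S_dominates:
  shows "integrable M (\<lambda>\<omega>. Z n \<omega> + B * S \<omega>)"
    and "AE \<omega> in M. cmod (s n \<omega>) * sqrt (B * S \<omega>) \<le> Z n \<omega> + B * S \<omega>"
proof -
  show "integrable M (\<lambda>\<omega>. Z n \<omega> + B * S \<omega>)" using Z_integrable S_integrable by simp
  show "AE \<omega> in M. cmod (s n \<omega>) * sqrt (B * S \<omega>) \<le> Z n \<omega> + B * S \<omega>"
    using summable_Z
  proof eventually_elim
    fix \<omega> assume Z: "summable (\<lambda>n. sqrt (\<mu> n) * Z n \<omega>)"
    have "0 \<le> S \<omega>" unfolding S_def by (intro suminf_nonneg[OF Z]) simp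
    then show "cmod (s n \<omega>) * sqrt (B * S \<omega>) \<le> Z n \<omega> + B * S \<omega>"
      using mult_le_sum_squares[of "cmod (s n \<omega>)" "sqrt (B * S \<omega>)"] B_nonneg by (simp add: Z_def)
  qed
qed

text \<open>Pairing with \<open>s n\<close> isolates one term of the series, since the coefficients
  are orthonormal; the expectations of the partial sums are constant as soon as
  \<open>N > n\<close>. The right-hand side involves the eigenfunction no longer, only the
  field.\<close>

lemma KL_coefficient:
  assumes x: "x \<in> \<Lambda>"
  shows "of_real (sqrt (\<mu> n)) * e n x = (\<integral>\<omega>. cnj (s n \<omega>) * \<phi> x \<omega> \<partial>M)"
proof -
  let ?P = "\<lambda>N \<omega>. \<Sum>m<N. s m \<omega> * of_real (sqrt (\<mu> m)) * e m x"
  have ints: "integrable M (\<lambda>\<omega>. cnj (s n \<omega>) * s m \<omega>)" for m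
  proof (rule Bochner_Integration.integrable_bound)
    show "integrable M (\<lambda>\<omega>. Z n \<omega> + Z m \<omega>)" using Z_integrable by simp
    show "AE \<omega> in M. norm (cnj (s n \<omega>) * s m \<omega>) \<le> norm (Z n \<omega> + Z m \<omega>)"
      by (auto simp: Z_def norm_mult intro!: mult_le_sum_squares)
  qed simp
  have part: "(\<integral>\<omega>. cnj (s n \<omega>) * ?P N \<omega> \<partial>M) = of_real (sqrt (\<mu> n)) * e n x" if "n < N" for N
  proof -
    have "(\<integral>\<omega>. cnj (s n \<omega>) * ?P N \<omega> \<partial>M) =
        (\<integral>\<omega>. (\<Sum>m<N. (cnj (s n \<omega>) * s m \<omega>) * (of_real (sqrt (\<mu> m)) * e m x)) \<partial>M)"
      by (simp add: sum_distrib_left mult_ac)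
    also have "\<dots> = (\<Sum>m<N. (\<integral>\<omega>. cnj (s n \<omega>) * s m \<omega> \<partial>M) * (of_real (sqrt (\<mu> m)) * e m x))"
      using ints by (subst Bochner_Integration.integral_sum) auto
    also have "\<dots> = of_real (sqrt (\<mu> n)) * e n x"
      unfolding s_cov using that by (subst sum.remove[of _ n]) (auto intro!: sum.neutral)
    finally show ?thesis .
  qed
  have "(\<lambda>N. \<integral>\<omega>. cnj (s n \<omega>) * ?P N \<omega> \<partial>M) \<longlonglongrightarrow> (\<integral>\<omega>. cnj (s n \<omega>) * \<phi> x \<omega> \<partial>M)"
  proof (rule integral_dominated_convergence[OF _ _ Z_S_dominates(1)])
    show "(\<lambda>\<omega>. cnj (s n \<omega>) * \<phi> x \<omega>) \<in> borel_measurable M"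
      using \<phi>_measurable[OF x] by measurable
    show "AE \<omega> in M. (\<lambda>N. cnj (s n \<omega>) * ?P N \<omega>) \<longlonglongrightarrow> cnj (s n \<omega>) * \<phi> x \<omega>"
      using KL[OF x] by eventually_elim (auto simp: sums_def intro: tendsto_mult_left)
    show "AE \<omega> in M. norm (cnj (s n \<omega>) * ?P N \<omega>) \<le> Z n \<omega> + B * S \<omega>" for N
      using summable_Z Z_S_dominates(2)[of n]
    proof eventually_elim
      fix \<omega> assume Z: "summable (\<lambda>n. sqrt (\<mu> n) * Z n \<omega>)"
        and dom: "cmod (s n \<omega>) * sqrt (B * S \<omega>) \<le> Z n \<omega> + B * S \<omega>"
      have "norm (cnj (s n \<omega>) * ?P N \<omega>) \<le> cmod (s n \<omega>) * sqrt (B * S \<omega>)"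
        unfolding norm_mult by (simp add: KL_bounds(2)[OF Z x] mult_left_mono)
      then show "norm (cnj (s n \<omega>) * ?P N \<omega>) \<le> Z n \<omega> + B * S \<omega>" using dom by simp
    qed
  qed simp
  moreover have "(\<lambda>N. \<integral>\<omega>. cnj (s n \<omega>) * ?P N \<omega> \<partial>M) \<longlonglongrightarrow> of_real (sqrt (\<mu> n)) * e n x"
    by (rule tendsto_eventually) (auto intro!: eventually_sequentiallyI[of "Suc n"] part)
  ultimately show ?thesis using LIMSEQ_unique by blast
qed

text \<open>Path continuity passes through the expectation by dominated convergence along sequences.
  The factor \<open>sqrt (\<mu> n)\<close> stays because nothing fixes the pointwise values of
  \<open>e n\<close> when \<open>\<mu> n = 0\<close>.\<close>

lemma continuous_on_KL_coefficient: "continuous_on \<Lambda> (\<lambda>x. of_real (sqrt (\<mu> n)) * e n x)"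
  unfolding continuous_on_sequentially
proof (intro allI ballI impI, elim conjE)
  fix d x assume x: "x \<in> \<Lambda>" and d: "\<forall>k. d k \<in> \<Lambda>" "d \<longlonglongrightarrow> x"
  have "(\<lambda>k. \<integral>\<omega>. cnj (s n \<omega>) * \<phi> (d k) \<omega> \<partial>M) \<longlonglongrightarrow> (\<integral>\<omega>. cnj (s n \<omega>) * \<phi> x \<omega> \<partial>M)"
  proof (rule integral_dominated_convergence[OF _ _ Z_S_dominates(1)])
    show "(\<lambda>\<omega>. cnj (s n \<omega>) * \<phi> x \<omega>) \<in> borel_measurable M"
      using \<phi>_measurable[OF x] by measurable
    show "(\<lambda>\<omega>. cnj (s n \<omega>) * \<phi> (d k) \<omega>) \<in> borel_measurable M" for k
      using \<phi>_measurable[OF spec[OF d(1), of k]] by measurable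
    show "AE \<omega> in M. (\<lambda>k. cnj (s n \<omega>) * \<phi> (d k) \<omega>) \<longlonglongrightarrow> cnj (s n \<omega>) * \<phi> x \<omega>"
      using cont
    proof eventually_elim
      fix \<omega> assume c: "continuous_on \<Lambda> (\<lambda>x. \<phi> x \<omega>)"
      show "(\<lambda>k. cnj (s n \<omega>) * \<phi> (d k) \<omega>) \<longlonglongrightarrow> cnj (s n \<omega>) * \<phi> x \<omega>"
        by (intro tendsto_mult_left continuous_on_tendsto_compose[OF c d(2) x]) (use d in auto)
    qed
    show "AE \<omega> in M. norm (cnj (s n \<omega>) * \<phi> (d k) \<omega>) \<le> Z n \<omega> + B * S \<omega>" for k
      using \<phi>_bound Z_S_dominates(2)[of n]
    proof eventually_elim
      fix \<omega> assume bd: "\<forall>x\<in>\<Lambda>. cmod (\<phi> x \<omega>) \<le> sqrt (B * S \<omega>)"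
        and dom: "cmod (s n \<omega>) * sqrt (B * S \<omega>) \<le> Z n \<omega> + B * S \<omega>"
      have "norm (cnj (s n \<omega>) * \<phi> (d k) \<omega>) \<le> cmod (s n \<omega>) * sqrt (B * S \<omega>)"
        unfolding norm_mult using bd d by (simp add: mult_left_mono)
      then show "norm (cnj (s n \<omega>) * \<phi> (d k) \<omega>) \<le> Z n \<omega> + B * S \<omega>" using dom by simp
    qed
  qed
  then show "((\<lambda>x. of_real (sqrt (\<mu> n)) * e n x) \<circ> d) \<longlonglongrightarrow> of_real (sqrt (\<mu> n)) * e n x"
    using d x by (simp add: KL_coefficient comp_def)
qed

text \<open>
  By the tail bound the series converges uniformly, so both sides of the expansion are continuous
  and the null set in the expansion can be chosen independently of the point.
\<close>

lemma KL_everywhere: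
  "AE \<omega> in M. \<forall>x\<in>\<Lambda>. (\<lambda>n. s n \<omega> * of_real (sqrt (\<mu> n)) * e n x) sums \<phi> x \<omega>"
proof -
  obtain D where "countable D" and D: "D \<subseteq> \<Lambda>" "\<Lambda> \<subseteq> closure D"
    and sums: "AE \<omega> in M. \<forall>x\<in>D. (\<lambda>n. s n \<omega> * of_real (sqrt (\<mu> n)) * e n x) sums \<phi> x \<omega>"
    by (rule KL_dense)
  from sums cont summable_Z show ?thesis
  proof eventually_elim
    fix \<omega> assume sums: "\<forall>x\<in>D. (\<lambda>n. s n \<omega> * of_real (sqrt (\<mu> n)) * e n x) sums \<phi> x \<omega>"
      and cont: "continuous_on \<Lambda> (\<lambda>x. \<phi> x \<omega>)" and Z: "summable (\<lambda>n. sqrt (\<mu> n) * Z n \<omega>)"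
    let ?c = "\<lambda>n x. s n \<omega> * of_real (sqrt (\<mu> n)) * e n x"
    define T where "T k = sqrt (B * (\<Sum>n. sqrt (\<mu> (n + k)) * Z (n + k) \<omega>))" for k
    have T: "T \<longlonglongrightarrow> 0"
    proof -
      have "(\<lambda>k. \<Sum>n. sqrt (\<mu> (n + k)) * Z (n + k) \<omega>) \<longlonglongrightarrow> 0"
        using suminf_exist_split2[OF Z] .
      then have "T \<longlonglongrightarrow> sqrt (B * 0)" unfolding T_def by (intro tendsto_intros)
      then show ?thesis by simp
    qed
    have "uniform_limit \<Lambda> (\<lambda>k x. \<Sum>n<k. ?c n x) (\<lambda>x. \<Sum>n. ?c n x) sequentially"
    proof (rule uniform_limitI)
      fix \<epsilon> :: real assume "0 < \<epsilon>"
      then have "\<forall>\<^sub>F k in sequentially. T k < \<epsilon>" using order_tendstoD(2)[OF T] by blast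
      then show "\<forall>\<^sub>F k in sequentially. \<forall>x\<in>\<Lambda>. dist (\<Sum>n<k. ?c n x) (\<Sum>n. ?c n x) < \<epsilon>"
      proof eventually_elim
        fix k assume k: "T k < \<epsilon>"
        show "\<forall>x\<in>\<Lambda>. dist (\<Sum>n<k. ?c n x) (\<Sum>n. ?c n x) < \<epsilon>"
        proof
          fix x assume x: "x \<in> \<Lambda>"
          have "(\<Sum>n. ?c n x) = (\<Sum>n. ?c (n + k) x) + (\<Sum>n<k. ?c n x)"
            by (rule suminf_split_initial_segment[OF KL_bounds(1)[OF Z x]])
          then have "dist (\<Sum>n<k. ?c n x) (\<Sum>n. ?c n x) = cmod (\<Sum>n. ?c (n + k) x)"
            by (simp add: dist_norm norm_minus_commute)
          also have "\<dots> \<le> T k" unfolding T_def by (rule KL_tail_bound[OF Z x])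
          finally show "dist (\<Sum>n<k. ?c n x) (\<Sum>n. ?c n x) < \<epsilon>" using k by simp
        qed
      qed
    qed
    moreover have "continuous_on \<Lambda> (\<lambda>x. \<Sum>n<k. ?c n x)" for k
      unfolding mult.assoc by (intro continuous_on_sum continuous_on_mult_left continuous_on_KL_coefficient)
    ultimately have ser: "continuous_on \<Lambda> (\<lambda>x. \<Sum>n. ?c n x)"
      by (intro uniform_limit_theorem[where F = sequentially]) auto
    show "\<forall>x\<in>\<Lambda>. (\<lambda>n. ?c n x) sums \<phi> x \<omega>"
    proof
      fix x assume x: "x \<in> \<Lambda>"
      then have "x \<in> closure D" using D(2) by blast
      then obtain d where d: "\<And>n. d n \<in> D" "d \<longlonglongrightarrow> x"
        unfolding closure_sequential by blast
      have d\<Lambda>: "d n \<in> \<Lambda>" for n using d(1) D by blast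
      have "(\<lambda>k. \<phi> (d k) \<omega>) \<longlonglongrightarrow> \<phi> x \<omega>"
        by (rule continuous_on_tendsto_compose[OF cont d(2) x]) (use d\<Lambda> in auto)
      moreover have "(\<lambda>k. \<Sum>n. ?c n (d k)) \<longlonglongrightarrow> (\<Sum>n. ?c n x)"
        by (rule continuous_on_tendsto_compose[OF ser d(2) x]) (use d\<Lambda> in auto)
      moreover have "(\<Sum>n. ?c n (d k)) = \<phi> (d k) \<omega>" for k
        using bspec[OF sums d(1)[of k]] by (rule sums_unique[symmetric])
      ultimately have "(\<Sum>n. ?c n x) = \<phi> x \<omega>" using LIMSEQ_unique by fastforce
      then show "(\<lambda>n. ?c n x) sums \<phi> x \<omega>"
        using summable_sums[OF KL_bounds(1)[OF Z x]] by simp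
    qed
  qed
qed

text \<open>Parseval is applied path by path. This needs the expansion at all points for the same
  \<omega>, and \<open>sqrt (B * S \<omega>)\<close> as a bound for the partial sums independent of
  the point.\<close>

lemma L2_norm_KL: "AE \<omega> in M. (\<lambda>n. \<mu> n * Z n \<omega>) sums (L2_norm \<Lambda> (\<lambda>x. \<phi> x \<omega>))\<^sup>2"
  using KL_everywhere summable_Z
proof eventually_elim
  fix \<omega> assume KL: "\<forall>x\<in>\<Lambda>. (\<lambda>n. s n \<omega> * of_real (sqrt (\<mu> n)) * e n x) sums \<phi> x \<omega>"
    and Z: "summable (\<lambda>n. sqrt (\<mu> n) * Z n \<omega>)"
  have "(\<lambda>n. (cmod (s n \<omega> * of_real (sqrt (\<mu> n))))\<^sup>2) sums (\<integral>x. (cmod (\<phi> x \<omega>))\<^sup>2 \<partial>lebesgue_on \<Lambda>)"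
  proof (rule Leb.orthonormal_series_integral[OF e_measurable e_square_integrable e_orthonormal])
    show "cmod (\<Sum>n<k. s n \<omega> * of_real (sqrt (\<mu> n)) * e n x) \<le> sqrt (B * S \<omega>)"
      if "x \<in> space (lebesgue_on \<Lambda>)" for k x
      using KL_bounds(2)[OF Z] that by simp
  qed (use KL in auto)
  moreover have "0 \<le> (\<integral>x. (cmod (\<phi> x \<omega>))\<^sup>2 \<partial>lebesgue_on \<Lambda>)" by (rule integral_nonneg_AE) simp
  ultimately show "(\<lambda>n. \<mu> n * Z n \<omega>) sums (L2_norm \<Lambda> (\<lambda>x. \<phi> x \<omega>))\<^sup>2"
    by (simp add: L2_norm_def norm_mult power_mult_distrib Z_def mult.commute)
qed

end

subsection \<open>Conditioning on a large norm\<close>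

locale kl_field_top = kl_field +
  fixes \<kappa> :: real
  assumes top: "largest_eigenvalue \<Lambda> C \<kappa>" and \<kappa>_pos: "0 < \<kappa>"
begin

definition g :: nat where "g = card {n. \<mu> n = \<kappa>}"

definition X :: "'a \<Rightarrow> real" where "X \<omega> = (\<Sum>n<g. \<kappa> * Z n \<omega>)"

text \<open>The maximum with 0 changes nothing where the series converges. It makes \<open>W\<close>
  nonnegative everywhere, even as a function of arbitrary real sequences, as the threshold shift
  demands.\<close>

definition W :: "'a \<Rightarrow> real" where "W \<omega> = max 0 (\<Sum>n. \<mu> (n + g) * Z (n + g) \<omega>)"

definition H :: "'a \<Rightarrow> real" where "H \<omega> = sqrt (B * (\<Sum>n. sqrt (\<mu> (n + g)) * Z (n + g) \<omega>))"

lemma mu_top: "n < g \<Longrightarrow> \<mu> n = \<kappa>" and g_pos: "0 < g" and mu_g: "\<mu> g < \<kappa>"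
  using spectral_system_top[OF spectral top \<kappa>_pos] unfolding g_def by auto

lemma X_measurable [measurable]: "X \<in> borel_measurable M"
  and W_measurable [measurable]: "W \<in> borel_measurable M"
  and H_measurable [measurable]: "H \<in> borel_measurable M"
  unfolding X_def W_def H_def by measurable

text \<open>Scaling by \<kappa> turns rate 1 into rate \<open>1 / \<kappa>\<close>, and
  \<open>g\<close> independent summands give shape \<open>g\<close>. The first parameter of
  \<open>erlang_density\<close> is the shape minus one.\<close>

lemma X_erlang: "distributed M lborel X (erlang_density (g - 1) (1 / \<kappa>))"
proof -
  have "distributed M lborel (\<lambda>\<omega>. \<Sum>n<g. \<kappa> * Z n \<omega>) (erlang_density (card {..<g} - 1) (1 / \<kappa>))"
  proof (rule exponential_distributed_sum)
    show "distributed M lborel (\<lambda>\<omega>. \<kappa> * Z n \<omega>) (exponential_density (1 / \<kappa>))" for n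
      using erlang_distributed_mult_const[OF Z_exponential[of n] \<kappa>_pos] by simp
    show "indep_vars (\<lambda>_. borel) (\<lambda>n \<omega>. \<kappa> * Z n \<omega>) {..<g}"
      by (rule indep_vars_compose2[OF indep_vars_subset[OF Z_indep]]) auto
  qed (use g_pos \<kappa>_pos in auto)
  then show ?thesis unfolding X_def[abs_def] by simp
qed

lemma mu_le_sqrt: "\<mu> n \<le> sqrt (\<mu> 0) * sqrt (\<mu> n)"
proof -
  have "\<mu> n = sqrt (\<mu> n) * sqrt (\<mu> n)" by simp
  also have "\<dots> \<le> sqrt (\<mu> 0) * sqrt (\<mu> n)"
    by (intro mult_right_mono real_sqrt_le_mono decseqD[OF mu_decseq]) auto
  finally show ?thesis .
qed

lemma summable_mu_Z:
  assumes Z: "summable (\<lambda>n. sqrt (\<mu> n) * Z n \<omega>)"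
  shows "summable (\<lambda>n. \<mu> n * Z n \<omega>)"
proof (rule summable_comparison_test')
  show "summable (\<lambda>n. sqrt (\<mu> 0) * (sqrt (\<mu> n) * Z n \<omega>))" using Z by (rule summable_mult)
  fix n
  have "\<mu> n * Z n \<omega> \<le> sqrt (\<mu> 0) * sqrt (\<mu> n) * Z n \<omega>"
    using mu_le_sqrt by (rule mult_right_mono) simp
  then show "norm (\<mu> n * Z n \<omega>) \<le> sqrt (\<mu> 0) * (sqrt (\<mu> n) * Z n \<omega>)" by simp
qed

lemma L2_norm_eq: "AE \<omega> in M. (L2_norm \<Lambda> (\<lambda>x. \<phi> x \<omega>))\<^sup>2 = X \<omega> + W \<omega>"
  using L2_norm_KL summable_Z
proof eventually_elim
  fix \<omega> assume sums: "(\<lambda>n. \<mu> n * Z n \<omega>) sums (L2_norm \<Lambda> (\<lambda>x. \<phi> x \<omega>))\<^sup>2"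
    and Z: "summable (\<lambda>n. sqrt (\<mu> n) * Z n \<omega>)"
  note mZ = summable_mu_Z[OF Z]
  have "(L2_norm \<Lambda> (\<lambda>x. \<phi> x \<omega>))\<^sup>2 = (\<Sum>n. \<mu> n * Z n \<omega>)"
    using sums by (rule sums_unique)
  also have "\<dots> = (\<Sum>n. \<mu> (n + g) * Z (n + g) \<omega>) + (\<Sum>n<g. \<mu> n * Z n \<omega>)"
    by (rule suminf_split_initial_segment[OF mZ])
  also have "(\<Sum>n<g. \<mu> n * Z n \<omega>) = X \<omega>" unfolding X_def by (rule sum.cong) (auto simp: mu_top)
  also have "(\<Sum>n. \<mu> (n + g) * Z (n + g) \<omega>) = W \<omega>"
    unfolding W_def
    using suminf_nonneg[OF summable_ignore_initial_segment[OF mZ, of g]] by simp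
  finally show "(L2_norm \<Lambda> (\<lambda>x. \<phi> x \<omega>))\<^sup>2 = X \<omega> + W \<omega>" by simp
qed

text \<open>Outside one null set the orthogonal part is the tail of the series from index
  \<open>g\<close> at every point simultaneously, so \<open>H\<close> bounds its supremum. The event
  itself bounds the denominator below by \<open>sqrt r\<close>.\<close>

lemma perp_bound:
  assumes r: "0 < r"
  shows "AE \<omega> in M. (L2_norm \<Lambda> (\<lambda>x. \<phi> x \<omega>))\<^sup>2 > r \<longrightarrow>
    uniform_norm \<Lambda> (field_perp_hat \<Lambda> \<mu> e s \<phi> \<kappa> \<omega>) \<le> ennreal (H \<omega> / sqrt r)"
  using KL_everywhere summable_Z
proof eventually_elim
  fix \<omega> assume KL: "\<forall>x\<in>\<Lambda>. (\<lambda>n. s n \<omega> * of_real (sqrt (\<mu> n)) * e n x) sums \<phi> x \<omega>"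
    and Z: "summable (\<lambda>n. sqrt (\<mu> n) * Z n \<omega>)"
  show "(L2_norm \<Lambda> (\<lambda>x. \<phi> x \<omega>))\<^sup>2 > r \<longrightarrow>
    uniform_norm \<Lambda> (field_perp_hat \<Lambda> \<mu> e s \<phi> \<kappa> \<omega>) \<le> ennreal (H \<omega> / sqrt r)"
  proof
    assume L: "(L2_norm \<Lambda> (\<lambda>x. \<phi> x \<omega>))\<^sup>2 > r"
    have "0 \<le> L2_norm \<Lambda> (\<lambda>x. \<phi> x \<omega>)"
      unfolding L2_norm_def by (intro real_sqrt_ge_zero integral_nonneg_AE) simp
    then have L': "sqrt r \<le> L2_norm \<Lambda> (\<lambda>x. \<phi> x \<omega>)"
      using L by (intro real_le_lsqrt) (use r in auto)
    show "uniform_norm \<Lambda> (field_perp_hat \<Lambda> \<mu> e s \<phi> \<kappa> \<omega>) \<le> ennreal (H \<omega> / sqrt r)"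
      unfolding uniform_norm_def
    proof (intro SUP_least ennreal_leI)
      fix x assume x: "x \<in> \<Lambda>"
      have "\<phi> x \<omega> = (\<Sum>n. s n \<omega> * of_real (sqrt (\<mu> n)) * e n x)"
        using bspec[OF KL x] by (rule sums_unique)
      also have "\<dots> = (\<Sum>n. s (n + g) \<omega> * of_real (sqrt (\<mu> (n + g))) * e (n + g) x) + field_par \<mu> e s \<kappa> \<omega> x"
        unfolding field_par_def g_def[symmetric]
        by (rule suminf_split_initial_segment[OF KL_bounds(1)[OF Z x]])
      finally have "cmod (\<phi> x \<omega> - field_par \<mu> e s \<kappa> \<omega> x) \<le> H \<omega>"
        using KL_tail_bound[OF Z x, of g] by (simp add: H_def)
      then have "cmod (\<phi> x \<omega> - field_par \<mu> e s \<kappa> \<omega> x) / L2_norm \<Lambda> (\<lambda>x. \<phi> x \<omega>) \<le> H \<omega> / sqrt r"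
        by (intro frac_le order_trans[OF norm_ge_zero] L') (use r in auto)
      moreover have "cmod (field_perp_hat \<Lambda> \<mu> e s \<phi> \<kappa> \<omega> x) =
          cmod (\<phi> x \<omega> - field_par \<mu> e s \<kappa> \<omega> x) / L2_norm \<Lambda> (\<lambda>x. \<phi> x \<omega>)"
        using \<open>0 \<le> L2_norm \<Lambda> (\<lambda>x. \<phi> x \<omega>)\<close> by (simp add: field_perp_hat_def norm_divide)
      ultimately show "cmod (field_perp_hat \<Lambda> \<mu> e s \<phi> \<kappa> \<omega> x) \<le> H \<omega> / sqrt r" by simp
    qed
  qed
qed

text \<open>
  As \<open>\<mu> g < \<kappa>\<close>, there is room to absorb \<open>H\<close> into the exponential by adding a small multiple of
  \<open>sqrt (\<mu> n)\<close> to the exponents \<open>\<mu> n / \<kappa>\<close>.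
\<close>

lemma H_exp_W_finite: "(\<integral>\<^sup>+\<omega>. ennreal (H \<omega>) * ennreal (exp (1 / \<kappa> * W \<omega>)) \<partial>M) < \<infinity>"
proof -
  \<comment> \<open>Chosen so that \<open>\<epsilon> * sqrt (\<mu> g)\<close> is at most half the
    gap \<open>1 - \<mu> g / \<kappa>\<close>. The added 1 avoids division by zero when
    \<open>\<mu> g = 0\<close>.\<close>
  define \<epsilon> where "\<epsilon> = (1 - \<mu> g / \<kappa>) / (2 * (sqrt (\<mu> g) + 1))"
  have gap: "0 < 1 - \<mu> g / \<kappa>" using mu_g \<kappa>_pos by simp
  have den: "0 < 2 * (sqrt (\<mu> g) + 1)" by (simp add: add_nonneg_pos)
  have \<epsilon>: "0 < \<epsilon>" unfolding \<epsilon>_def using gap den by (rule divide_pos_pos)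
  define q where "q = \<epsilon> * sqrt (\<mu> g) + \<mu> g / \<kappa>"
  have q: "q < 1"
  proof -
    have "\<epsilon> * sqrt (\<mu> g) \<le> \<epsilon> * (sqrt (\<mu> g) + 1)" using \<epsilon> by simp
    also have "\<dots> = (1 - \<mu> g / \<kappa>) / 2" unfolding \<epsilon>_def using den by (simp add: field_simps)
    finally show ?thesis unfolding q_def using gap by simp
  qed
  \<comment> \<open>The exponents vanish on the top block, so the moment bound for series over all
    indices applies although \<open>H\<close> and \<open>W\<close> start at
    \<open>g\<close>.\<close>
  define a where "a n = (if n < g then 0 else \<epsilon> * sqrt (\<mu> n) + \<mu> n / \<kappa>)" for n
  have a0: "0 \<le> a n" for n unfolding a_def using \<epsilon> \<kappa>_pos by simp
  have q0: "0 \<le> q" unfolding q_def using \<epsilon> \<kappa>_pos by simp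
  have aq: "a n \<le> q" for n
  proof (cases "n < g")
    case False
    then have "\<mu> n \<le> \<mu> g" using decseqD[OF mu_decseq] by simp
    then show ?thesis unfolding a_def q_def using False \<epsilon> \<kappa>_pos
      by (auto intro!: add_mono mult_left_mono divide_right_mono)
  qed (simp add: a_def q0)
  have sum_mu: "summable \<mu>"
  proof (rule summable_comparison_test')
    show "summable (\<lambda>n. sqrt (\<mu> 0) * sqrt (\<mu> n))" using summable_sqrt_mu by (rule summable_mult)
    show "norm (\<mu> n) \<le> sqrt (\<mu> 0) * sqrt (\<mu> n)" for n using mu_le_sqrt[of n] by simp
  qed
  have sa: "summable a"
  proof (rule summable_comparison_test')
    show "summable (\<lambda>n. \<epsilon> * sqrt (\<mu> n) + \<mu> n / \<kappa>)"
      by (intro summable_add summable_mult summable_divide summable_sqrt_mu sum_mu)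
    show "norm (a n) \<le> \<epsilon> * sqrt (\<mu> n) + \<mu> n / \<kappa>" for n
      unfolding a_def using \<epsilon> \<kappa>_pos by simp
  qed
  have exponent: "AE \<omega> in M. summable (\<lambda>n. a n * Z n \<omega>) \<and>
    H \<omega> * exp (1 / \<kappa> * W \<omega>) \<le> (1 + B / \<epsilon>) * exp (\<Sum>n. a n * Z n \<omega>)"
    using summable_Z
  proof eventually_elim
    fix \<omega> assume Z: "summable (\<lambda>n. sqrt (\<mu> n) * Z n \<omega>)"
    note mZ = summable_mu_Z[OF Z]
    define Y where "Y = (\<Sum>n. sqrt (\<mu> (n + g)) * Z (n + g) \<omega>)"
    note Zg = summable_ignore_initial_segment[OF Z, of g]
    note mZg = summable_ignore_initial_segment[OF mZ, of g]
    have Y: "0 \<le> Y" unfolding Y_def by (rule suminf_nonneg[OF Zg]) simp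
    have W: "W \<omega> = (\<Sum>n. \<mu> (n + g) * Z (n + g) \<omega>)"
      unfolding W_def using suminf_nonneg[OF mZg] by simp
    have shift: "a (n + g) * Z (n + g) \<omega> =
        \<epsilon> * (sqrt (\<mu> (n + g)) * Z (n + g) \<omega>) + 1 / \<kappa> * (\<mu> (n + g) * Z (n + g) \<omega>)" for n
      by (simp add: a_def algebra_simps)
    have sum_shift: "(\<lambda>n. a (n + g) * Z (n + g) \<omega>) sums (\<epsilon> * Y + 1 / \<kappa> * W \<omega>)"
      unfolding shift W Y_def by (intro sums_add sums_mult summable_sums Zg mZg)
    then have saZ: "summable (\<lambda>n. a n * Z n \<omega>)"
      by (subst summable_iff_shift[symmetric, of _ g]) (rule sums_summable)
    have "(\<Sum>n. a n * Z n \<omega>) = (\<Sum>n. a (n + g) * Z (n + g) \<omega>) + (\<Sum>n<g. a n * Z n \<omega>)"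
      by (rule suminf_split_initial_segment[OF saZ])
    also have "(\<Sum>n<g. a n * Z n \<omega>) = 0" by (rule sum.neutral) (simp add: a_def)
    also have "(\<Sum>n. a (n + g) * Z (n + g) \<omega>) = \<epsilon> * Y + 1 / \<kappa> * W \<omega>"
      using sum_shift by (rule sums_unique[symmetric])
    finally have suma: "(\<Sum>n. a n * Z n \<omega>) = \<epsilon> * Y + 1 / \<kappa> * W \<omega>" by simp
    \<comment> \<open>The square root is made linear in \<open>Y\<close> and then exponential.
      Expanding \<open>(1 + B / \<epsilon>) * (1 + \<epsilon> * Y)\<close> shows the terms 1 and
      \<open>B * Y\<close> plus nonnegative ones, hence the constant.\<close>
    have "sqrt (B * Y) \<le> 1 + B * Y"
    proof (rule real_le_lsqrt)
      show "B * Y \<le> (1 + B * Y)\<^sup>2"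
        using B_nonneg Y by (simp add: power2_eq_square algebra_simps)
    qed (use B_nonneg Y in simp)
    also have "\<dots> \<le> (1 + B / \<epsilon>) * (1 + \<epsilon> * Y)"
      using B_nonneg Y \<epsilon> by (simp add: field_simps)
    also have "\<dots> \<le> (1 + B / \<epsilon>) * exp (\<epsilon> * Y)"
      using B_nonneg \<epsilon> by (intro mult_left_mono exp_ge_add_one_self) simp
    finally have "H \<omega> \<le> (1 + B / \<epsilon>) * exp (\<epsilon> * Y)" unfolding H_def Y_def .
    then have "H \<omega> * exp (1 / \<kappa> * W \<omega>) \<le> (1 + B / \<epsilon>) * exp (\<epsilon> * Y) * exp (1 / \<kappa> * W \<omega>)"
      by (rule mult_right_mono) simp
    also have "\<dots> = (1 + B / \<epsilon>) * exp (\<Sum>n. a n * Z n \<omega>)"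
      by (simp only: suma exp_add mult.assoc)
    finally show "summable (\<lambda>n. a n * Z n \<omega>) \<and>
        H \<omega> * exp (1 / \<kappa> * W \<omega>) \<le> (1 + B / \<epsilon>) * exp (\<Sum>n. a n * Z n \<omega>)"
      using saZ by simp
  qed
  have fin: "(\<integral>\<^sup>+\<omega>. ennreal (exp (\<Sum>n. a n * Z n \<omega>)) \<partial>M) < \<infinity>"
    by (rule nn_integral_exp_exponential_series[OF Z_exponential Z_indep a0 aq q sa])
      (use exponent in eventually_elim, simp)
  have "(\<integral>\<^sup>+\<omega>. ennreal (H \<omega>) * ennreal (exp (1 / \<kappa> * W \<omega>)) \<partial>M) \<le>
      (\<integral>\<^sup>+\<omega>. ennreal (1 + B / \<epsilon>) * ennreal (exp (\<Sum>n. a n * Z n \<omega>)) \<partial>M)"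
  proof (rule nn_integral_mono_AE, use exponent in eventually_elim)
    fix \<omega> assume *: "summable (\<lambda>n. a n * Z n \<omega>) \<and>
        H \<omega> * exp (1 / \<kappa> * W \<omega>) \<le> (1 + B / \<epsilon>) * exp (\<Sum>n. a n * Z n \<omega>)"
    have "ennreal (H \<omega>) * ennreal (exp (1 / \<kappa> * W \<omega>)) = ennreal (H \<omega> * exp (1 / \<kappa> * W \<omega>))"
      by (rule ennreal_mult''[symmetric]) simp
    also have "\<dots> \<le> ennreal ((1 + B / \<epsilon>) * exp (\<Sum>n. a n * Z n \<omega>))"
      using * by (intro ennreal_leI) simp
    also have "\<dots> = ennreal (1 + B / \<epsilon>) * ennreal (exp (\<Sum>n. a n * Z n \<omega>))"
      by (rule ennreal_mult'') simp
    finally show "ennreal (H \<omega>) * ennreal (exp (1 / \<kappa> * W \<omega>)) \<le>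
      ennreal (1 + B / \<epsilon>) * ennreal (exp (\<Sum>n. a n * Z n \<omega>))" .
  qed
  also have "\<dots> = ennreal (1 + B / \<epsilon>) * (\<integral>\<^sup>+\<omega>. ennreal (exp (\<Sum>n. a n * Z n \<omega>)) \<partial>M)"
    by (rule nn_integral_cmult) simp
  also have "\<dots> < \<infinity>" using fin by (simp add: ennreal_mult_less_top)
  finally show ?thesis .
qed

text \<open>\<open>X\<close> depends on the coordinates of \<open>Z\<close> below \<open>g\<close>,
  while \<open>H\<close> and \<open>W\<close> depend on those from \<open>g\<close> on. Disjoint
  blocks of an independent family are independent, so the threshold shift applies with shift
  \<open>W\<close> and rate \<open>1 / \<kappa>\<close>.\<close>

lemma H_tail_integral:
  assumes r: "0 \<le> r"
  shows "(\<integral>\<^sup>+\<omega>. ennreal (H \<omega>) * indicator {\<omega>. r < X \<omega> + W \<omega>} \<omega> \<partial>M) \<le>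
    (\<integral>\<^sup>+\<omega>. ennreal (H \<omega>) * ennreal (exp (1 / \<kappa> * W \<omega>)) \<partial>M) * emeasure M {\<omega> \<in> space M. r < X \<omega>}"
proof -
  let ?U = "\<lambda>\<omega>. restrict (\<lambda>i. Z i \<omega>) {..<g}" and ?V = "\<lambda>\<omega>. restrict (\<lambda>i. Z i \<omega>) {g..}"
  let ?f = "\<lambda>u. \<Sum>n<g. \<kappa> * u n :: real"
  let ?w = "\<lambda>v. max 0 (\<Sum>n. \<mu> (n + g) * v (n + g)) :: real"
  let ?h = "\<lambda>v. sqrt (B * (\<Sum>n. sqrt (\<mu> (n + g)) * v (n + g)))"
  have ind: "indep_var (PiM {..<g} (\<lambda>_. borel)) ?U (PiM {g..} (\<lambda>_. borel)) ?V"
    by (rule indep_var_restrict[OF Z_indep]) auto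
  have XU: "X \<omega> = ?f (?U \<omega>)" and WV: "W \<omega> = ?w (?V \<omega>)" and HV: "H \<omega> = ?h (?V \<omega>)" for \<omega>
    by (simp_all add: X_def W_def H_def)
  \<comment> \<open>The index \<open>n + g\<close> always lies in \<open>{g..}\<close>, so it is a
    genuine coordinate of the restricted product.\<close>
  have [measurable]: "(\<lambda>v. v (n + g)) \<in> borel_measurable (PiM {g..} (\<lambda>_. borel :: real measure))" for n
    by (rule measurable_component_singleton) simp
  show ?thesis
    unfolding WV HV unfolding XU
  proof (rule nn_integral_erlang_shift[OF ind])
    show "?f \<in> borel_measurable (PiM {..<g} (\<lambda>_. borel))" by measurable
    show "?h \<in> borel_measurable (PiM {g..} (\<lambda>_. borel))" by measurable
    show "?w \<in> borel_measurable (PiM {g..} (\<lambda>_. borel))" by measurable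
    show "distributed M lborel (\<lambda>\<omega>. ?f (?U \<omega>)) (erlang_density (g - 1) (1 / \<kappa>))"
      using X_erlang unfolding XU[abs_def] .
  qed (use r \<kappa>_pos in auto)
qed

text \<open>The tail of \<open>X\<close> that bounds the numerator is positive and at most the
  probability of the conditioning event, so the quotient keeps only the expectation and the factor
  \<open>1 / sqrt r\<close>.\<close>

lemma conditional_bound:
  assumes r: "0 < r"
  shows "(\<integral>\<^sup>+\<omega>. uniform_norm \<Lambda> (field_perp_hat \<Lambda> \<mu> e s \<phi> \<kappa> \<omega>)
      \<partial>uniform_measure (completion M) {\<omega> \<in> space M. (L2_norm \<Lambda> (\<lambda>x. \<phi> x \<omega>))\<^sup>2 > r}) \<le>
    ennreal (1 / sqrt r) * (\<integral>\<^sup>+\<omega>. ennreal (H \<omega>) * ennreal (exp (1 / \<kappa> * W \<omega>)) \<partial>M)"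
proof -
  let ?A = "{\<omega> \<in> space M. (L2_norm \<Lambda> (\<lambda>x. \<phi> x \<omega>))\<^sup>2 > r}"
  let ?A' = "{\<omega> \<in> space M. r < X \<omega> + W \<omega>}"
  let ?K = "\<integral>\<^sup>+\<omega>. ennreal (H \<omega>) * ennreal (exp (1 / \<kappa> * W \<omega>)) \<partial>M"
  have AA': "AE \<omega> in M. \<omega> \<in> ?A' \<longleftrightarrow> \<omega> \<in> ?A"
    using L2_norm_eq by eventually_elim auto
  have A'[measurable]: "?A' \<in> sets M" by measurable
  \<comment> \<open>The event is defined through path norms and is only known to agree almost surely
    with the measurable set \<open>?A'\<close>; this makes it measurable in the completion.\<close>
  have A: "?A \<in> sets (completion M)"
    by (rule completion.in_sets_AE[OF AE_completion[OF AA']]) auto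
  have emA: "emeasure (completion M) ?A = emeasure M ?A'"
  proof -
    have "emeasure (completion M) ?A' = emeasure (completion M) ?A"
      by (rule emeasure_eq_AE[OF AE_completion[OF AA'] _ A]) (rule sets_completionI_sets[OF A'])
    moreover have "emeasure (completion M) ?A' = emeasure M ?A'"
      by (simp add: A' main_part_sets)
    ultimately show ?thesis by simp
  qed
  have Xpos: "0 < emeasure M {\<omega> \<in> space M. r < X \<omega>}"
    using erlang_tail_shift(2)[OF X_erlang, of 0 r] r \<kappa>_pos by (simp add: emeasure_eq_measure)
  have XA: "emeasure M {\<omega> \<in> space M. r < X \<omega>} \<le> emeasure M ?A'"
    by (rule emeasure_mono[OF _ A']) (auto simp: W_def)
  \<comment> \<open>Almost-everywhere monotonicity of the integral asks for no measurability, so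
    none has to be shown for the uniform norm.\<close>
  have "(\<integral>\<^sup>+\<omega>. uniform_norm \<Lambda> (field_perp_hat \<Lambda> \<mu> e s \<phi> \<kappa> \<omega>) \<partial>uniform_measure (completion M) ?A) \<le>
      (\<integral>\<^sup>+\<omega>. ennreal (H \<omega> / sqrt r) \<partial>uniform_measure (completion M) ?A)"
  proof (rule nn_integral_mono_AE[OF AE_uniform_measureI[OF A]])
    show "AE \<omega> in completion M. \<omega> \<in> ?A \<longrightarrow>
        uniform_norm \<Lambda> (field_perp_hat \<Lambda> \<mu> e s \<phi> \<kappa> \<omega>) \<le> ennreal (H \<omega> / sqrt r)"
      by (rule AE_completion) (use perp_bound[OF r] in eventually_elim, simp)
  qed
  also have "\<dots> = (\<integral>\<^sup>+\<omega>. ennreal (H \<omega> / sqrt r) * indicator ?A \<omega> \<partial>completion M) / emeasure M ?A'"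
    unfolding emA[symmetric]
    by (rule nn_integral_uniform_measure[OF _ A]) (rule measurable_completion, simp)
  also have "(\<integral>\<^sup>+\<omega>. ennreal (H \<omega> / sqrt r) * indicator ?A \<omega> \<partial>completion M) =
      (\<integral>\<^sup>+\<omega>. ennreal (1 / sqrt r) * (ennreal (H \<omega>) * indicator {\<omega>. r < X \<omega> + W \<omega>} \<omega>) \<partial>M)"
    unfolding nn_integral_completion
  proof (rule nn_integral_cong_AE, use AA' AE_space in eventually_elim)
    fix \<omega> assume "\<omega> \<in> ?A' \<longleftrightarrow> \<omega> \<in> ?A" "\<omega> \<in> space M"
    then have "indicator ?A \<omega> = (indicator {\<omega>. r < X \<omega> + W \<omega>} \<omega> :: ennreal)"
      by (simp add: indicator_def)
    moreover have "ennreal (H \<omega> / sqrt r) = ennreal (1 / sqrt r) * ennreal (H \<omega>)"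
      using r by (subst ennreal_mult'[symmetric]) auto
    ultimately show "ennreal (H \<omega> / sqrt r) * indicator ?A \<omega> =
        ennreal (1 / sqrt r) * (ennreal (H \<omega>) * indicator {\<omega>. r < X \<omega> + W \<omega>} \<omega>)"
      by (simp only: mult.assoc)
  qed
  also have "\<dots> = ennreal (1 / sqrt r) * (\<integral>\<^sup>+\<omega>. ennreal (H \<omega>) * indicator {\<omega>. r < X \<omega> + W \<omega>} \<omega> \<partial>M)"
    by (rule nn_integral_cmult) measurable
  also have "\<dots> / emeasure M ?A' \<le> ennreal (1 / sqrt r) * ?K"
  proof (rule divide_le_posI_ennreal)
    show "0 < emeasure M ?A'" using Xpos XA by (rule less_le_trans)
    have "(\<integral>\<^sup>+\<omega>. ennreal (H \<omega>) * indicator {\<omega>. r < X \<omega> + W \<omega>} \<omega> \<partial>M) \<le> ?K * emeasure M ?A'"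
      using H_tail_integral[of r] r mult_left_mono[OF XA, of ?K] by (auto intro: order_trans)
    then show "ennreal (1 / sqrt r) * (\<integral>\<^sup>+\<omega>. ennreal (H \<omega>) * indicator {\<omega>. r < X \<omega> + W \<omega>} \<omega> \<partial>M) \<le>
        emeasure M ?A' * (ennreal (1 / sqrt r) * ?K)"
      by (simp add: mult.assoc mult.left_commute mult.commute mult_left_mono)
  qed
  finally show ?thesis .
qed

lemma conditional_limit:
  "((\<lambda>r. \<integral>\<^sup>+\<omega>. uniform_norm \<Lambda> (field_perp_hat \<Lambda> \<mu> e s \<phi> \<kappa> \<omega>)
      \<partial>uniform_measure (completion M) {\<omega> \<in> space M. (L2_norm \<Lambda> (\<lambda>x. \<phi> x \<omega>))\<^sup>2 > r}) \<longlongrightarrow> 0) at_top"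
proof (rule tendsto_sandwich[where f = "\<lambda>_. 0"])
  let ?K = "\<integral>\<^sup>+\<omega>. ennreal (H \<omega>) * ennreal (exp (1 / \<kappa> * W \<omega>)) \<partial>M"
  show "\<forall>\<^sub>F r in at_top. (\<integral>\<^sup>+\<omega>. uniform_norm \<Lambda> (field_perp_hat \<Lambda> \<mu> e s \<phi> \<kappa> \<omega>)
      \<partial>uniform_measure (completion M) {\<omega> \<in> space M. (L2_norm \<Lambda> (\<lambda>x. \<phi> x \<omega>))\<^sup>2 > r}) \<le>
    ennreal (1 / sqrt r) * ?K"
    using eventually_gt_at_top[of 0] by eventually_elim (rule conditional_bound)
  have "((\<lambda>r. 1 / sqrt r) \<longlongrightarrow> 0) at_top"
    by (rule tendsto_divide_0[OF tendsto_const filterlim_at_top_imp_at_infinity[OF sqrt_at_top]])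
  then have "((\<lambda>r. ennreal (1 / sqrt r)) \<longlongrightarrow> ennreal 0) at_top" by (rule tendsto_ennrealI)
  \<comment> \<open>Finiteness of \<open>?K\<close> is essential here: multiplication by infinity is
    not continuous at 0.\<close>
  then have "((\<lambda>r. ?K * ennreal (1 / sqrt r)) \<longlongrightarrow> ?K * ennreal 0) at_top"
    by (rule ennreal_tendsto_cmult[rotated]) (use H_exp_W_finite in simp)
  then show "((\<lambda>r. ennreal (1 / sqrt r) * ?K) \<longlongrightarrow> 0) at_top" by (simp add: mult.commute)
qed auto

end

theorem proposition2:
  fixes \<Lambda> :: "(real ^ 'd) set"
    and M :: "'w measure"
    and \<phi> :: "(real ^ 'd) \<Rightarrow> 'w \<Rightarrow> complex"
    and C :: "(real ^ 'd) \<Rightarrow> (real ^ 'd) \<Rightarrow> complex"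
    and \<mu> :: "nat \<Rightarrow> real"
    and e :: "nat \<Rightarrow> (real ^ 'd) \<Rightarrow> complex"
    and s :: "nat \<Rightarrow> 'w \<Rightarrow> complex"
    and \<kappa>\<^sub>1 :: real
  assumes "bounded \<Lambda>" and "\<Lambda> \<in> sets lebesgue"
    and "prob_space M"
    and "complex_gaussian_field M \<Lambda> \<phi>"
    and "\<And>x. x \<in> \<Lambda> \<Longrightarrow> (\<integral>\<omega>. \<phi> x \<omega> \<partial>M) = 0"
    and "\<And>x y. x \<in> \<Lambda> \<Longrightarrow> y \<in> \<Lambda> \<Longrightarrow> (\<integral>\<omega>. \<phi> x \<omega> * \<phi> y \<omega> \<partial>M) = 0"
    and "\<And>x y. x \<in> \<Lambda> \<Longrightarrow> y \<in> \<Lambda> \<Longrightarrow> (\<integral>\<omega>. \<phi> x \<omega> * cnj (\<phi> y \<omega>) \<partial>M) = C x y"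
    and "spectral_system \<Lambda> C \<mu> e"
    and "largest_eigenvalue \<Lambda> C \<kappa>\<^sub>1" and "\<kappa>\<^sub>1 > 0"
    and "iid_std_complex_gaussian M s"
    and "\<And>x. x \<in> \<Lambda> \<Longrightarrow>
           AE \<omega> in M. (\<lambda>n. s n \<omega> * of_real (sqrt (\<mu> n)) * e n x) sums \<phi> x \<omega>"
    and "AE \<omega> in M. continuous_on \<Lambda> (\<lambda>x. \<phi> x \<omega>)"
    and "\<And>x. x \<in> \<Lambda> \<Longrightarrow> summable (\<lambda>n. sqrt (\<mu> n) * (cmod (e n x))\<^sup>2)"
    and "bounded ((\<lambda>x. \<Sum>n. sqrt (\<mu> n) * (cmod (e n x))\<^sup>2) ` \<Lambda>)"
  shows "((\<lambda>r. \<integral>\<^sup>+\<omega>. uniform_norm \<Lambda> (field_perp_hat \<Lambda> \<mu> e s \<phi> \<kappa>\<^sub>1 \<omega>)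
                \<partial>uniform_measure (completion M)
                   {\<omega> \<in> space M. (L2_norm \<Lambda> (\<lambda>x. \<phi> x \<omega>))\<^sup>2 > r}) \<longlongrightarrow> 0) at_top"
proof -
  let ?D = "\<lambda>x. \<Sum>n. sqrt (\<mu> n) * (cmod (e n x))\<^sup>2"
  interpret prob_space M by fact
  obtain b where b: "\<And>x. x \<in> \<Lambda> \<Longrightarrow> \<bar>?D x\<bar> \<le> b"
    using \<open>bounded (?D ` \<Lambda>)\<close> unfolding bounded_iff by auto
  have \<phi>_measurable: "\<phi> x \<in> borel_measurable M" if "x \<in> \<Lambda>" for x
  proof -
    have "complex_gaussian_rv M (\<lambda>\<omega>. \<Sum>i\<in>{x}. 1 * \<phi> i \<omega>)"
      using \<open>complex_gaussian_field M \<Lambda> \<phi>\<close>[unfolded complex_gaussian_field_def, rule_format, of "{x}" "\<lambda>_. 1"] that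
      by simp
    then show ?thesis using complex_gaussian_borel_measurable by simp
  qed
  \<comment> \<open>The maximum with 0 provides a nonnegative bound without appealing to a point of
    \<Lambda>.\<close>
  interpret kl_field_top M \<Lambda> C \<phi> \<mu> e s "max 0 b" \<kappa>\<^sub>1
  proof
    show "?D x \<le> max 0 b" if "x \<in> \<Lambda>" for x
      using b[OF that] by linarith
  qed (use assms \<phi>_measurable in auto)
  show ?thesis by (rule conditional_limit)
qed

end
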